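(* Let $(M,a,b,g)$ be the data of an $N$-dimensional Finsleroid--Finsler space ($N\ge2$) with Finsleroid--Finsler metric function $K(x,y)$, where $a_{ij}(x)$ is a Riemannian metric, $b=b_i(x)y^i$ is a 1-form of unit Riemannian length, and $g=g(x)$ is the Finsleroid charge, $-2<g(x)<2$ (possibly depending on $x$). Then the spray coefficients $G^k=\gamma^k{}_{ij}y^iy^j$ of the space have the explicit form $$G^k=gq\Bigl[a^{kj}+(p\,b^k+r\,y^k)b^j\Bigr]y^h(\nabla_hb_j-\nabla_jb_h)+\frac gq\,(y^k-b\,b^k)(ys)+a^k{}_{mn}y^my^n+E^k,$$ where $$p=\frac{gb}{q},\qquad r=-\frac gq,\qquad (ys)=y^hs_h,\quad s_k=y^m\nabla_kb_m,$$ and $$E^k=M\,(yg)\,y^k+\frac12K^2(yg)\,M_h\,g^{kh}-\frac12MK^2\,g_h\,g^{kh},$$ with $$M=-\frac{1}{h^3}f+\frac{G}{2hB}\,q^2+\frac{1}{h^2B}\,bq,\qquad M_h=\frac{\partial M}{\partial y^h},\qquad g_h=\frac{\partial g}{\partial x^h},\qquad (yg)=y^ig_i.$$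
   Context: Finsleroid--Finsler space. Let $M$ be an $N$-dimensional $C^\infty$ manifold ($N\ge2$) with a positive-definite Riemannian metric $a_{ij}(x)$ and a non-vanishing 1-form $b=b_i(x)y^i$ with $a^{ij}b_ib_j=1$; $b^i=a^{ij}b_j$. (The letter $M$ in the formula for $E^k$ denotes the scalar given there, not the manifold.) For a nonzero tangent vector $y$ put $S=\sqrt{a_{ij}(x)y^iy^j}$ and $q=\sqrt{S^2-b^2}$. Let $g=g(x)$ be a scalar function with $-2<g(x)<2$ (the Finsleroid charge), and put $$h=\sqrt{1-\tfrac14 g^2},\quad G=\frac gh,\quad B=b^2+gbq+q^2,\quad L=q+\frac g2 b,$$ $$K(x,y)=\sqrt{B}\;e^{-\frac12 G f},\qquad f=-\arctan\frac G2+\arctan\frac{L}{hb}\ \text{ if } b\ge0,\qquad f=\pi-\arctan\frac G2+\arctan\frac{L}{hb}\ \text{ if } b\le0$$ (at $b=0$, $f=\frac{\pi}{2}-\arctan\frac G2$). $K$ is the Finsleroid--Finsler metric function. Objects are considered at $y$ with $q>0$. $g_{ij}=\frac12\frac{\partial^2K^2}{\partial y^i\partial y^j}$ is the Finslerian metric tensor, $g^{ij}$ its inverse, and $$\gamma^k{}_{ij}=\frac12 g^{kn}\left(\frac{\partial g_{ni}}{\partial x^j}+\frac{\partial g_{nj}}{\partial x^i}-\frac{\partial g_{ji}}{\partial x^n}\right).$$ $a^k{}_{ij}=\frac12a^{kn}(\partial_ja_{ni}+\partial_ia_{nj}-\partial_na_{ji})$ are the Christoffel symbols of $a_{ij}$,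 and $\nabla_ib_j=\partial_ib_j-b_ka^k{}_{ij}$ is the Riemannian covariant derivative. *)

theory Defs
  imports "HOL-Analysis.Analysis"
begin

section \<open>Partial derivatives and smooth functions\<close>

definition partial :: "'n::finite \<Rightarrow> (real^'n \<Rightarrow> real) \<Rightarrow> real^'n \<Rightarrow> real" where
  "partial i f x = deriv (\<lambda>t. f (x + t *\<^sub>R axis i 1)) 0"

text \<open>Both notions below are meant for open \<open>U\<close> only.\<close>

primrec Ck_on :: "nat \<Rightarrow> (real^'n::finite) set \<Rightarrow> (real^'n \<Rightarrow> real) \<Rightarrow> bool" where
  "Ck_on 0 U f \<longleftrightarrow> continuous_on U f"
| "Ck_on (Suc k) U f \<longleftrightarrow> f differentiable_on U \<and> (\<forall>i. Ck_on k U (partial i f))"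

definition smooth_on :: "(real^'n::finite) set \<Rightarrow> (real^'n \<Rightarrow> real) \<Rightarrow> bool" where
  "smooth_on U f \<longleftrightarrow> (\<forall>k. Ck_on k U f)"

section \<open>Smooth manifolds and tensor fields\<close>

type_synonym ('m, 'n) chart = "'m set \<times> ('m \<Rightarrow> real^'n)"

definition chart_image :: "('m, 'n::finite) chart \<Rightarrow> (real^'n) set" where
  "chart_image c = snd c ` fst c"

definition chart_inv :: "('m, 'n::finite) chart \<Rightarrow> real^'n \<Rightarrow> 'm" where
  "chart_inv c = inv_into (fst c) (snd c)"

definition transition :: "('m, 'n::finite) chart \<Rightarrow> ('m, 'n) chart \<Rightarrow> real^'n \<Rightarrow> real^'n" where
  "transition c c' = snd c' \<circ> chart_inv c"

definition chart_overlap :: "('m, 'n::finite) chart \<Rightarrow> ('m, 'n) chart \<Rightarrow> (real^'n) set" where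
  "chart_overlap c c' = snd c ` (fst c \<inter> fst c')"

definition smooth_manifold :: "'m topology \<Rightarrow> ('m, 'n::finite) chart set \<Rightarrow> bool" where
  "smooth_manifold X \<A> \<longleftrightarrow>
     Hausdorff_space X \<and> second_countable X \<and> (\<Union>c\<in>\<A>. fst c) = topspace X \<and>
     (\<forall>c\<in>\<A>. openin X (fst c) \<and> open (chart_image c) \<and>
        homeomorphic_map (subtopology X (fst c)) (top_of_set (chart_image c)) (snd c)) \<and>
     (\<forall>c\<in>\<A>. \<forall>c'\<in>\<A>. \<forall>k. smooth_on (chart_overlap c c') (\<lambda>x. transition c c' x $ k))"

text \<open>Tensor fields are given by their component functions in each chart,
  subject to the transformation law under changes of charts.\<close>

definition smooth_scalar :: "('m, 'n::finite) chart set \<Rightarrow> ('m \<Rightarrow> real) \<Rightarrow> bool" where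
  "smooth_scalar \<A> g \<longleftrightarrow> (\<forall>c\<in>\<A>. smooth_on (chart_image c) (g \<circ> chart_inv c))"

definition smooth_one_form ::
    "('m, 'n::finite) chart set \<Rightarrow> (('m, 'n) chart \<Rightarrow> real^'n \<Rightarrow> real^'n) \<Rightarrow> bool" where
  "smooth_one_form \<A> b \<longleftrightarrow>
     (\<forall>c\<in>\<A>. \<forall>i. smooth_on (chart_image c) (\<lambda>x. b c x $ i)) \<and>
     (\<forall>c\<in>\<A>. \<forall>c'\<in>\<A>. \<forall>x\<in>chart_overlap c c'. \<forall>i.
        b c x $ i = (\<Sum>k\<in>UNIV. partial i (\<lambda>z. transition c c' z $ k) x
                                * b c' (transition c c' x) $ k))"

definition riemannian_metric ::
    "('m, 'n::finite) chart set \<Rightarrow> (('m, 'n) chart \<Rightarrow> real^'n \<Rightarrow> real^'n^'n) \<Rightarrow> bool" where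
  "riemannian_metric \<A> a \<longleftrightarrow>
     (\<forall>c\<in>\<A>. \<forall>i j. smooth_on (chart_image c) (\<lambda>x. a c x $ i $ j)) \<and>
     (\<forall>c\<in>\<A>. \<forall>c'\<in>\<A>. \<forall>x\<in>chart_overlap c c'. \<forall>i j.
        a c x $ i $ j = (\<Sum>k\<in>UNIV. \<Sum>l\<in>UNIV.
            partial i (\<lambda>z. transition c c' z $ k) x * partial j (\<lambda>z. transition c c' z $ l) x
            * a c' (transition c c' x) $ k $ l)) \<and>
     (\<forall>c\<in>\<A>. \<forall>x\<in>chart_image c.
        (\<forall>i j. a c x $ i $ j = a c x $ j $ i) \<and>
        (\<forall>v. v \<noteq> 0 \<longrightarrow> (\<Sum>i\<in>UNIV. \<Sum>j\<in>UNIV. a c x $ i $ j * v $ i * v $ j) > 0))"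

definition finsleroid_data ::
    "'m topology \<Rightarrow> ('m, 'n::finite) chart set \<Rightarrow> (('m, 'n) chart \<Rightarrow> real^'n \<Rightarrow> real^'n^'n)
     \<Rightarrow> (('m, 'n) chart \<Rightarrow> real^'n \<Rightarrow> real^'n) \<Rightarrow> ('m \<Rightarrow> real) \<Rightarrow> bool" where
  "finsleroid_data X \<A> a b g \<longleftrightarrow>
     CARD('n) \<ge> 2 \<and> smooth_manifold X \<A> \<and>
     riemannian_metric \<A> a \<and> smooth_one_form \<A> b \<and> smooth_scalar \<A> g \<and>
     (\<forall>c\<in>\<A>. \<forall>x\<in>chart_image c.
        (\<Sum>i\<in>UNIV. \<Sum>j\<in>UNIV. matrix_inv (a c x) $ i $ j * b c x $ i * b c x $ j) = 1) \<and>
     (\<forall>p\<in>topspace X. -2 < g p \<and> g p < 2)"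

section \<open>The Finsleroid--Finsler metric function in local coordinates\<close>

text \<open>From here on \<open>a\<close>, \<open>b\<close>, \<open>g\<close> are the component functions in one chart, \<open>x\<close> is a coordinate
  vector and \<open>y\<close> lists the components of a tangent vector. Functions of \<open>(g, b, q)\<close>
  alone take these three numbers as arguments.\<close>

definition form_val :: "(real^'n::finite \<Rightarrow> real^'n) \<Rightarrow> real^'n \<Rightarrow> real^'n \<Rightarrow> real" where
  "form_val b x y = (\<Sum>i\<in>UNIV. b x $ i * y $ i)"

definition riem_norm :: "(real^'n::finite \<Rightarrow> real^'n^'n) \<Rightarrow> real^'n \<Rightarrow> real^'n \<Rightarrow> real" where
  "riem_norm a x y = sqrt (\<Sum>i\<in>UNIV. \<Sum>j\<in>UNIV. a x $ i $ j * y $ i * y $ j)"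

definition fs_q ::
    "(real^'n::finite \<Rightarrow> real^'n^'n) \<Rightarrow> (real^'n \<Rightarrow> real^'n) \<Rightarrow> real^'n \<Rightarrow> real^'n \<Rightarrow> real" where
  "fs_q a b x y = sqrt ((riem_norm a x y)\<^sup>2 - (form_val b x y)\<^sup>2)"

definition fs_h :: "real \<Rightarrow> real" where
  "fs_h g = sqrt (1 - g\<^sup>2 / 4)"

definition fs_G :: "real \<Rightarrow> real" where
  "fs_G g = g / fs_h g"

definition fs_B :: "real \<Rightarrow> real \<Rightarrow> real \<Rightarrow> real" where
  "fs_B g b q = b\<^sup>2 + g * b * q + q\<^sup>2"

definition fs_L :: "real \<Rightarrow> real \<Rightarrow> real \<Rightarrow> real" where
  "fs_L g b q = q + g / 2 * b"

text \<open>The value at \<open>b = 0\<close> is the common limit of the two branches for \<open>q > 0\<close>.\<close>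

definition fs_f :: "real \<Rightarrow> real \<Rightarrow> real \<Rightarrow> real" where
  "fs_f g b q =
     (if b > 0 then - arctan (fs_G g / 2) + arctan (fs_L g b q / (fs_h g * b))
      else if b < 0 then pi - arctan (fs_G g / 2) + arctan (fs_L g b q / (fs_h g * b))
      else pi / 2 - arctan (fs_G g / 2))"

definition fs_M :: "real \<Rightarrow> real \<Rightarrow> real \<Rightarrow> real" where
  "fs_M g b q =
     - (1 / fs_h g ^ 3) * fs_f g b q
     + fs_G g / (2 * fs_h g * fs_B g b q) * q\<^sup>2
     + 1 / ((fs_h g)\<^sup>2 * fs_B g b q) * b * q"

definition fs_K ::
    "(real^'n::finite \<Rightarrow> real^'n^'n) \<Rightarrow> (real^'n \<Rightarrow> real^'n) \<Rightarrow> (real^'n \<Rightarrow> real)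
     \<Rightarrow> real^'n \<Rightarrow> real^'n \<Rightarrow> real" where
  "fs_K a b g x y =
     sqrt (fs_B (g x) (form_val b x y) (fs_q a b x y))
     * exp (- (1 / 2) * fs_G (g x) * fs_f (g x) (form_val b x y) (fs_q a b x y))"

section \<open>Christoffel symbols, covariant derivative, spray coefficients\<close>

definition finsler_tensor ::
    "(real^'n::finite \<Rightarrow> real^'n \<Rightarrow> real) \<Rightarrow> real^'n \<Rightarrow> real^'n \<Rightarrow> real^'n^'n" where
  "finsler_tensor K x y = (\<chi> i j. 1 / 2 * partial i (partial j (\<lambda>v. (K x v)\<^sup>2)) y)"

definition christoffel ::
    "(real^'n::finite \<Rightarrow> real^'n^'n) \<Rightarrow> real^'n \<Rightarrow> 'n \<Rightarrow> 'n \<Rightarrow> 'n \<Rightarrow> real" where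
  "christoffel m x k i j = 1 / 2 * (\<Sum>n\<in>UNIV. matrix_inv (m x) $ k $ n *
      (partial j (\<lambda>z. m z $ n $ i) x + partial i (\<lambda>z. m z $ n $ j) x
       - partial n (\<lambda>z. m z $ j $ i) x))"

text \<open>\<open>cov_deriv a b x i j\<close> stands for \<open>\<nabla>\<^sub>i b\<^sub>j\<close>.\<close>

definition cov_deriv ::
    "(real^'n::finite \<Rightarrow> real^'n^'n) \<Rightarrow> (real^'n \<Rightarrow> real^'n) \<Rightarrow> real^'n \<Rightarrow> 'n \<Rightarrow> 'n \<Rightarrow> real" where
  "cov_deriv a b x i j =
     partial i (\<lambda>z. b z $ j) x - (\<Sum>k\<in>UNIV. b x $ k * christoffel a x k i j)"

text \<open>The Finslerian Christoffel symbols are formed with \<open>y\<close> held constant.\<close>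

definition spray ::
    "(real^'n::finite \<Rightarrow> real^'n \<Rightarrow> real) \<Rightarrow> real^'n \<Rightarrow> real^'n \<Rightarrow> 'n \<Rightarrow> real" where
  "spray K x y k = (\<Sum>i\<in>UNIV. \<Sum>j\<in>UNIV.
      christoffel (\<lambda>z. finsler_tensor K z y) x k i j * y $ i * y $ j)"

end

theory Submission
  imports Defs
begin

text \<open>As \<open>y\<^sup>i y\<^sup>j \<partial>\<^sub>j g\<^sub>n\<^sub>i = y\<^sup>j \<partial>\<^sub>j y\<^sub>n\<close>, the lowered spray \<open>g\<^sub>n\<^sub>k G\<^sup>k\<close> is
  \<open>y\<^sup>j \<partial>\<^sub>j y\<^sub>n - 1/2 \<partial>\<^sub>n K\<^sup>2\<close>. Write \<open>K\<^sup>2 = B W\<close> with \<open>W = exp (- G f)\<close>. Since \<open>\<partial>f/\<partial>b = - h q / B\<close> and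
  \<open>\<partial>f/\<partial>q = h b / B\<close>, one finds \<open>\<partial>K\<^sup>2/\<partial>b = 2 (b + g q) W\<close>, \<open>\<partial>K\<^sup>2/\<partial>q = 2 q W\<close>, hence
  \<open>y\<^sub>n = W (a\<^sub>n\<^sub>i y\<^sup>i + g q b\<^sub>n)\<close>, while \<open>\<partial>K\<^sup>2/\<partial>g = M K\<^sup>2\<close> produces \<open>E\<^sup>k\<close>. The remaining terms are
  compared after lowering the index of the claimed right-hand side with the explicit tensor \<open>g\<^sub>n\<^sub>k\<close>,
  which is shown to have trivial kernel.\<close>

section \<open>Derivatives of the Finsleroid functions along curves\<close>

lemma fs_h_pos: "fs_h g > 0" if "-2 < g" "g < 2"
proof -
  have "g\<^sup>2 < 2\<^sup>2" using that by (intro power2_strict_mono) auto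
  then show ?thesis by (simp add: fs_h_def)
qed

lemma fs_h_sq: "(fs_h g)\<^sup>2 = 1 - g\<^sup>2 / 4" if "-2 < g" "g < 2"
  using fs_h_pos[OF that] by (simp add: fs_h_def)

text \<open>Completing the square in \<open>q\<close>, with h^2 = 1 - g^2/4. The sum of squares
  gives positivity of \<open>B\<close> and turns 1 + (L/(h b))^2, which arises from differentiating
  the arctangent, into B/(h b)^2.\<close>

lemma fs_B_eq: "fs_B g b q = (fs_h g * b)\<^sup>2 + (fs_L g b q)\<^sup>2" if "-2 < g" "g < 2"
  by (simp add: power_mult_distrib fs_h_sq[OF that] fs_B_def fs_L_def)
     (simp add: power2_eq_square field_simps)

lemma fs_B_pos: "fs_B g b q > 0" if "-2 < g" "g < 2" "q > 0"
proof (cases "b = 0")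
  case True
  then show ?thesis using that by (simp add: fs_B_def)
next
  case False
  then show ?thesis using that fs_h_pos[of g] by (simp add: fs_B_eq add_pos_nonneg)
qed

lemma fs_h_has_derivative [derivative_intros]:
  assumes "(g has_real_derivative g') (at t)" "-2 < g t" "g t < 2"
  shows "((\<lambda>s. fs_h (g s)) has_real_derivative - g t * g' / (4 * fs_h (g t))) (at t)"
proof -
  have "1 - (g t)\<^sup>2 / 4 > 0"
    using fs_h_pos[OF assms(2,3)] by (simp add: fs_h_def)
  then show ?thesis
    unfolding fs_h_def using assms(1)
    by (auto intro!: derivative_eq_intros simp: field_simps)
qed

text \<open>The quotient rule leaves h^2 + g^2/4 = 1 in the numerator.\<close>

lemma fs_G_has_derivative [derivative_intros]:
  assumes "(g has_real_derivative g') (at t)" "-2 < g t" "g t < 2"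
  shows "((\<lambda>s. fs_G (g s)) has_real_derivative g' / fs_h (g t) ^ 3) (at t)"
proof -
  define h where "h = fs_h (g t)"
  have h: "h > 0" "h\<^sup>2 = 1 - (g t)\<^sup>2 / 4"
    using fs_h_pos fs_h_sq assms by (auto simp: h_def)
  have "((\<lambda>s. fs_G (g s)) has_real_derivative
      (g' * h - g t * (- g t * g' / (4 * h))) / (h * h)) (at t)"
    unfolding fs_G_def h_def using assms h
    by (auto intro!: derivative_eq_intros simp: h_def)
  moreover have "(g' * h - g t * (- g t * g' / (4 * h))) / (h * h) = g' * (h\<^sup>2 + (g t)\<^sup>2 / 4) / h ^ 3"
    using h(1) by (simp add: field_simps power2_eq_square power3_eq_cube)
  ultimately show ?thesis using h by (simp add: h_def)
qed

lemma fs_G_arctan_has_derivative: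
  assumes "(g has_real_derivative g') (at t)" "-2 < g t" "g t < 2"
  shows "((\<lambda>s. arctan (fs_G (g s) / 2)) has_real_derivative g' / (2 * fs_h (g t))) (at t)"
proof -
  define h where "h = fs_h (g t)"
  have h: "h > 0" "h\<^sup>2 = 1 - (g t)\<^sup>2 / 4"
    using fs_h_pos fs_h_sq assms by (auto simp: h_def)
  have "1 + (fs_G (g t) / 2)\<^sup>2 = (h\<^sup>2 + (g t)\<^sup>2 / 4) / h\<^sup>2"
    using h(1) by (simp add: fs_G_def h_def[symmetric] power_divide field_simps)
  then have i: "inverse (1 + (fs_G (g t) / 2)\<^sup>2) = h\<^sup>2"
    using h by simp
  have "((\<lambda>s. arctan (fs_G (g s) / 2)) has_real_derivative
      inverse (1 + (fs_G (g t) / 2)\<^sup>2) * (g' / h ^ 3 / 2)) (at t)"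
    unfolding h_def using assms by (auto intro!: derivative_eq_intros)
  then show ?thesis
    unfolding i using h(1) by (simp add: h_def[symmetric] power2_eq_square power3_eq_cube mult.commute)
qed

text \<open>Sign conditions at \<open>t\<close> spread to a neighbourhood through this limit;
  \<open>nhds\<close>, which includes the point itself, is the filter of
  \<open>DERIV_cong_ev\<close>.\<close>

lemma DERIV_imp_tendsto_nhds:
  "(f has_real_derivative D) (at t) \<Longrightarrow> (f \<longlongrightarrow> f t) (nhds t)"
  using DERIV_isCont[of f D t] unfolding isCont_def tendsto_at_iff_tendsto_nhds .

text \<open>All three arguments move along the curve, so one rule serves both fibre directions,
  where \<open>g\<close> is constant, and base directions, where it varies.\<close>

lemma fs_f_has_derivative:
  assumes g: "(g has_real_derivative g') (at t)" "-2 < g t" "g t < 2"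
    and b: "(b has_real_derivative b') (at t)"
    and q: "(q has_real_derivative q') (at t)" "q t > 0"
  shows "((\<lambda>s. fs_f (g s) (b s) (q s)) has_real_derivative
      fs_h (g t) * (b t * q' - q t * b') / fs_B (g t) (b t) (q t)
      - ((q t)\<^sup>2 + g t * b t * q t / 2) / (2 * fs_h (g t) * fs_B (g t) (b t) (q t)) * g') (at t)"
    (is "(_ has_real_derivative ?D) _")
proof -
  define h h' L L' B where "h = fs_h (g t)" and "h' = - g t * g' / (4 * h)"
    and "L = fs_L (g t) (b t) (q t)" and "L' = q' + (g' * b t + g t * b') / 2"
    and "B = fs_B (g t) (b t) (q t)"
  have h: "h > 0" "h\<^sup>2 = 1 - (g t)\<^sup>2 / 4"
    using fs_h_pos fs_h_sq g by (auto simp: h_def)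
  have B: "B > 0" "B = (h * b t)\<^sup>2 + L\<^sup>2"
    using fs_B_pos fs_B_eq g q by (auto simp: B_def h_def L_def)
  have dh: "((\<lambda>s. fs_h (g s)) has_real_derivative h') (at t)"
    unfolding h'_def h_def using g by (rule fs_h_has_derivative)
  have dL: "((\<lambda>s. fs_L (g s) (b s) (q s)) has_real_derivative L') (at t)"
    unfolding L'_def fs_L_def by (auto intro!: derivative_eq_intros g b q simp: field_simps)
  note dG = fs_G_arctan_has_derivative[OF g, folded h_def]
  \<comment> \<open>The target is rewritten as the quotient rule for L/(h b), with the square of h b
    already exchanged for \<open>B\<close>, minus the derivative of arctan(G/2). Both cases below
    arrive at this form.\<close>
  have D: "?D = (L' * (h * b t) - L * (h' * b t + h * b')) / B - g' / (2 * h)"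
  proof -
    have "L' * (h * b t) - L * (h' * b t + h * b')
        = h * (b t * q' - q t * b') + (h\<^sup>2 * (b t)\<^sup>2 / 2 + L * g t * b t / 4) / h * g'"
      using h(1) by (simp add: L'_def L_def fs_L_def h'_def field_simps power2_eq_square)
    also have "h\<^sup>2 * (b t)\<^sup>2 / 2 + L * g t * b t / 4 = (B - ((q t)\<^sup>2 + g t * b t * q t / 2)) / 2"
      unfolding h B_def L_def fs_L_def fs_B_def by (simp add: field_simps power2_eq_square)
    finally show ?thesis
      unfolding h_def[symmetric] B_def[symmetric]
      by (rule ssubst) (use h(1) B(1) in \<open>simp add: field_simps\<close>)
  qed
  show ?thesis
  \<comment> \<open>Near \<open>b = 0\<close> both branches of \<open>f\<close> are one arctangent of the reciprocal, as \<open>L = q > 0\<close> there.\<close>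
  proof (cases "b t = 0")
    case False
    \<comment> \<open>Away from b = 0 the two branches differ only by this additive constant, and
      the sign of \<open>b\<close> is locally constant.\<close>
    define C where "C = (if b t > 0 then 0 else pi)"
    have "eventually (\<lambda>s. b s * b t > 0) (nhds t)"
    proof -
      have "((\<lambda>s. b s * b t) \<longlongrightarrow> b t * b t) (nhds t)"
        by (intro tendsto_mult tendsto_const DERIV_imp_tendsto_nhds[OF b])
      then show ?thesis using False by (intro order_tendstoD(1)[where y = "b t * b t"]) (auto simp: zero_less_mult_iff)
    qed
    then have ev: "eventually (\<lambda>s. fs_f (g s) (b s) (q s) =
        C - arctan (fs_G (g s) / 2) + arctan (fs_L (g s) (b s) (q s) / (fs_h (g s) * b s))) (nhds t)"
      by eventually_elim (auto simp: fs_f_def C_def zero_less_mult_iff)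
    have "((\<lambda>s. C - arctan (fs_G (g s) / 2) + arctan (fs_L (g s) (b s) (q s) / (fs_h (g s) * b s)))
        has_real_derivative (0 - g' / (2 * h) + inverse (1 + (L / (h * b t))\<^sup>2) *
          ((L' * (h * b t) - L * (h' * b t + b' * h)) / ((h * b t) * (h * b t))))) (at t)"
      unfolding L_def h_def using False h(1)
      by (intro DERIV_add DERIV_diff DERIV_const dG[unfolded h_def] DERIV_chain2[OF DERIV_arctan]
           DERIV_divide dL DERIV_mult dh b) (auto simp: h_def)
    moreover have "inverse (1 + (L / (h * b t))\<^sup>2) = (h * b t)\<^sup>2 / B"
      using False h(1) B(1) unfolding B(2) by (simp add: power_divide field_simps)
    ultimately show ?thesis
      unfolding D using ev False h(1)
      by (subst DERIV_cong_ev[OF refl ev refl]) (simp add: power2_eq_square mult_ac)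
  next
    case True
    have "L > 0" using True q by (simp add: L_def fs_L_def)
    have "eventually (\<lambda>s. fs_L (g s) (b s) (q s) > 0) (nhds t)"
      using order_tendstoD(1)[OF DERIV_imp_tendsto_nhds[OF dL]] \<open>L > 0\<close> by (simp add: L_def)
    moreover have "eventually (\<lambda>s. g s > -2) (nhds t)" "eventually (\<lambda>s. g s < 2) (nhds t)"
      using order_tendstoD[OF DERIV_imp_tendsto_nhds[OF g(1)]] g(2,3) by auto
    ultimately have ev: "eventually (\<lambda>s. fs_f (g s) (b s) (q s) =
        pi / 2 - arctan (fs_G (g s) / 2) - arctan (fs_h (g s) * b s / fs_L (g s) (b s) (q s))) (nhds t)"
    proof eventually_elim
      case (elim s)
      define z where "z = fs_h (g s) * b s / fs_L (g s) (b s) (q s)"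
      have inv: "1 / z = fs_L (g s) (b s) (q s) / (fs_h (g s) * b s)" by (simp add: z_def)
      \<comment> \<open>The term sgn(z) pi/2 in the reciprocal formula for the arctangent brings the
        offsets 0 and pi of the two branches to the common value pi/2.\<close>
      have "sgn z = sgn (b s)"
        using elim fs_h_pos[of "g s"] by (simp add: z_def sgn_mult sgn_divide)
      moreover from this have "z \<noteq> 0" if "b s \<noteq> 0" using that by (auto simp: sgn_if split: if_splits)
      ultimately have "arctan (1 / z) = sgn (b s) * pi / 2 - arctan z" if "b s \<noteq> 0"
        using Transcendental.arctan_inverse[of z] that by metis
      then show ?case unfolding inv by (auto simp: fs_f_def z_def)
    qed
    have "((\<lambda>s. pi / 2 - arctan (fs_G (g s) / 2) - arctan (fs_h (g s) * b s / fs_L (g s) (b s) (q s)))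
        has_real_derivative (0 - g' / (2 * h) - inverse (1 + (h * b t / L)\<^sup>2) *
          (((h' * b t + b' * h) * L - h * b t * L') / (L * L)))) (at t)"
      unfolding L_def h_def using \<open>L > 0\<close>
      by (intro DERIV_diff DERIV_const dG[unfolded h_def] DERIV_chain2[OF DERIV_arctan]
           DERIV_divide dL DERIV_mult dh b) (auto simp: L_def)
    moreover have "inverse (1 + (h * b t / L)\<^sup>2) = L\<^sup>2 / B"
      using \<open>L > 0\<close> B(1) unfolding B(2) by (simp add: power_divide field_simps)
    moreover have "0 - g' / (2 * h) - L\<^sup>2 / B * (((h' * b t + b' * h) * L - h * b t * L') / (L * L)) = ?D"
      unfolding D using \<open>L > 0\<close> B(1) by (simp add: field_simps power2_eq_square)
    ultimately show ?thesis
      by (subst DERIV_cong_ev[OF refl ev refl]) simp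
  qed
qed

text \<open>\<open>K\<^sup>2 = fs_B * fs_W\<close> where \<open>q > 0\<close>; splitting off \<open>fs_B\<close> keeps all derivatives rational in
  \<open>(g, b, q)\<close> up to the factor \<open>fs_W\<close> and \<open>fs_M\<close>.\<close>

definition fs_W :: "real \<Rightarrow> real \<Rightarrow> real \<Rightarrow> real" where
  "fs_W g b q = exp (- fs_G g * fs_f g b q)"

lemma fs_W_pos: "fs_W g b q > 0"
  by (simp add: fs_W_def)

text \<open>In the \<open>b'\<close> and \<open>q'\<close> terms the factor h of df cancels against
  G = g/h. Since dB/dg = b q, subtracting b q/B from \<open>fs_M\<close> makes the g-derivative of B
  W equal to M B W.\<close>

lemma fs_W_has_derivative:
  assumes g: "(g has_real_derivative g') (at t)" "-2 < g t" "g t < 2"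
    and b: "(b has_real_derivative b') (at t)"
    and q: "(q has_real_derivative q') (at t)" "q t > 0"
  shows "((\<lambda>s. fs_W (g s) (b s) (q s)) has_real_derivative
      fs_W (g t) (b t) (q t) *
        (g t * (q t * b' - b t * q') / fs_B (g t) (b t) (q t)
         + (fs_M (g t) (b t) (q t) - b t * q t / fs_B (g t) (b t) (q t)) * g')) (at t)"
proof -
  define h f B where "h = fs_h (g t)" and "f = fs_f (g t) (b t) (q t)" and "B = fs_B (g t) (b t) (q t)"
  have h: "h > 0" "h\<^sup>2 = 1 - (g t)\<^sup>2 / 4"
    using fs_h_pos fs_h_sq g by (auto simp: h_def f_def B_def)
  have B: "B > 0"
    using fs_B_pos g q by (auto simp: h_def f_def B_def)
  define D where "D = h * (b t * q' - q t * b') / B - ((q t)\<^sup>2 + g t * b t * q t / 2) / (2 * h * B) * g'"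
  have "((\<lambda>s. fs_W (g s) (b s) (q s)) has_real_derivative
     exp (- fs_G (g t) * f) * (- (g' / h ^ 3) * f + D * - fs_G (g t))) (at t)"
    unfolding fs_W_def h_def f_def B_def D_def
    by (intro DERIV_chain2[OF DERIV_exp] DERIV_mult DERIV_minus fs_G_has_derivative fs_f_has_derivative assms)
  moreover have "- (g' / h ^ 3) * f + D * - fs_G (g t) =
      g t * (q t * b' - b t * q') / B + (fs_M (g t) (b t) (q t) - b t * q t / B) * g'"
  proof -
    \<comment> \<open>With 1 - h^2 = g^2/4 the two b q terms merge into the one that G times the
      g-derivative of f produces.\<close>
    have "b t * q t / (h\<^sup>2 * B) - b t * q t / B = (g t)\<^sup>2 / 4 * (b t * q t) / (h\<^sup>2 * B)"
    proof -
      have "b t * q t / (h\<^sup>2 * B) - b t * q t / B = (1 - h\<^sup>2) * (b t * q t) / (h\<^sup>2 * B)"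
        using h(1) B by (simp add: field_simps)
      then show ?thesis by (simp add: h(2))
    qed
    then have "fs_M (g t) (b t) (q t) - b t * q t / B = - (1 / h ^ 3) * f + g t / h / (2 * h * B) * (q t)\<^sup>2
        + (g t)\<^sup>2 / 4 * (b t * q t) / (h\<^sup>2 * B)"
      by (simp add: fs_M_def fs_G_def h_def[symmetric] f_def[symmetric] B_def[symmetric])
    then show ?thesis
      by (rule ssubst)
         (use h(1) B in \<open>simp add: D_def fs_G_def h_def[symmetric] field_simps power2_eq_square power3_eq_cube\<close>)
  qed
  ultimately show ?thesis by (simp add: fs_W_def h_def f_def B_def)
qed

text \<open>In the product rule all quotients by \<open>B\<close> disappear: the contributions g q
  of both factors add up in the \<open>b'\<close> part, g b cancels in the \<open>q'\<close> part,
  and b q cancels in the \<open>g'\<close> part.\<close>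

lemma fs_BW_has_derivative:
  assumes g: "(g has_real_derivative g') (at t)" "-2 < g t" "g t < 2"
    and b: "(b has_real_derivative b') (at t)"
    and q: "(q has_real_derivative q') (at t)" "q t > 0"
  shows "((\<lambda>s. fs_B (g s) (b s) (q s) * fs_W (g s) (b s) (q s)) has_real_derivative
      2 * fs_W (g t) (b t) (q t) * ((b t + g t * q t) * b' + q t * q')
      + fs_M (g t) (b t) (q t) * (fs_B (g t) (b t) (q t) * fs_W (g t) (b t) (q t)) * g') (at t)"
proof -
  define B W M where "B = fs_B (g t) (b t) (q t)" and "W = fs_W (g t) (b t) (q t)" and "M = fs_M (g t) (b t) (q t)"
  have B: "B > 0"
    using fs_B_pos g q by (auto simp: B_def)
  have "((\<lambda>s. fs_B (g s) (b s) (q s)) has_real_derivative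
      2 * b t * b' + (g' * b t + g t * b') * q t + g t * b t * q' + 2 * q t * q') (at t)"
    unfolding fs_B_def by (auto intro!: derivative_eq_intros g b q simp: field_simps)
  from DERIV_mult[OF this fs_W_has_derivative[OF assms]] show ?thesis
    unfolding B_def[symmetric] W_def[symmetric] M_def[symmetric]
    by (rule back_subst[where P = "\<lambda>D. (_ has_real_derivative D) _"])
       (use B in \<open>simp add: field_simps\<close>)
qed

text \<open>Here \<open>g\<close> is fixed because only the fibre derivative M_h occurs in E^k. The
  right-hand side is arranged so that (b + g q) b' + q q' can later be read as a component of
  \<open>fs_v\<close>.\<close>

lemma fs_M_has_derivative:
  assumes g: "-2 < g" "g < 2"
    and b: "(b has_real_derivative b') (at t)"
    and q: "(q has_real_derivative q') (at t)" "q t > 0"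
  shows "((\<lambda>s. fs_M g (b s) (q s)) has_real_derivative
      2 * q t / fs_B g (b t) (q t) *
        (b' - b t * ((b t + g * q t) * b' + q t * q') / fs_B g (b t) (q t))) (at t)"
proof -
  define h B where "h = fs_h g" and "B = fs_B g (b t) (q t)"
  have h: "h > 0" "h\<^sup>2 = 1 - g\<^sup>2 / 4"
    using fs_h_pos fs_h_sq g by (auto simp: h_def B_def)
  have B: "B > 0" "B = (b t)\<^sup>2 + g * b t * q t + (q t)\<^sup>2"
    using fs_B_pos g q by (auto simp: h_def B_def fs_B_def)
  define B' where "B' = 2 * b t * b' + g * b' * q t + g * b t * q' + 2 * q t * q'"
  have dB: "((\<lambda>s. fs_B g (b s) (q s)) has_real_derivative B') (at t)"
    unfolding fs_B_def B'_def by (auto intro!: derivative_eq_intros b q simp: field_simps)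
  have df: "((\<lambda>s. fs_f g (b s) (q s)) has_real_derivative h * (b t * q' - q t * b') / B) (at t)"
    using fs_f_has_derivative[OF DERIV_const g b q] by (simp add: h_def B_def)
  have "fs_M g b q = - (1 / h ^ 3) * fs_f g b q + (g / 2 * q\<^sup>2 + b * q) / h\<^sup>2 / fs_B g b q" for b q
    by (simp add: fs_M_def fs_G_def h_def B_def add_divide_distrib power2_eq_square)
  moreover have "((\<lambda>s. - (1 / h ^ 3) * fs_f g (b s) (q s) + (g / 2 * (q s)\<^sup>2 + b s * q s) / h\<^sup>2 / fs_B g (b s) (q s))
     has_real_derivative - (1 / h ^ 3) * (h * (b t * q' - q t * b') / B) +
      ((g * q t * q' + b' * q t + b t * q') / h\<^sup>2 * B - (g / 2 * (q t)\<^sup>2 + b t * q t) / h\<^sup>2 * B') / (B * B)) (at t)"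
    using B(1) h(1) unfolding h_def B_def
    by (auto intro!: derivative_eq_intros b q dB df[unfolded h_def B_def] simp: field_simps)
  moreover have "- (1 / h ^ 3) * (h * (b t * q' - q t * b') / B) +
      ((g * q t * q' + b' * q t + b t * q') / h\<^sup>2 * B - (g / 2 * (q t)\<^sup>2 + b t * q t) / h\<^sup>2 * B') / (B * B)
      = 2 * q t / B * (b' - b t * ((b t + g * q t) * b' + q t * q') / B)" (is "?l = ?r")
  proof -
    have "?l = ((2 * q t * b' + g * q t * q') * B - (g / 2 * (q t)\<^sup>2 + b t * q t) * B') / (h\<^sup>2 * B\<^sup>2)"
      using h(1) B(1) by (simp add: field_simps power2_eq_square power3_eq_cube)
    \<comment> \<open>The numerator contains the factor h^2 = 1 - g^2/4, so \<open>h\<close> drops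
      out of the result.\<close>
    also have "(2 * q t * b' + g * q t * q') * B - (g / 2 * (q t)\<^sup>2 + b t * q t) * B'
        = h\<^sup>2 * (2 * q t * (B * b' - b t * ((b t + g * q t) * b' + q t * q')))"
      unfolding h(2) B(2) B'_def by (simp add: field_simps power2_eq_square)
    also have "\<dots> / (h\<^sup>2 * B\<^sup>2) = ?r"
      using h(1) B(1) by (simp add: field_simps power2_eq_square)
    finally show ?thesis .
  qed
  ultimately show ?thesis by (simp add: h_def B_def)
qed

section \<open>Christoffel symbols and linear algebra at a point\<close>

text \<open>\<open>deriv\<close> is a choice operator, so \<open>partial\<close> carries information
  only where a derivative exists; differentiability guarantees this along coordinate lines.\<close>

lemma partial_has_derivative:
  assumes "f differentiable (at x)"
  shows "((\<lambda>t. f (x + t *\<^sub>R axis i 1)) has_real_derivative partial i f x) (at 0)"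
proof -
  have "(\<lambda>t. x + t *\<^sub>R axis i 1) differentiable (at (0::real))"
    by (intro differentiable_add differentiable_const differentiable_scaleR differentiable_ident)
  then have "(f \<circ> (\<lambda>t. x + t *\<^sub>R axis i 1)) differentiable (at (0::real))"
    using assms by (intro differentiable_chain_at) auto
  then show ?thesis
    by (simp add: partial_def DERIV_deriv_iff_real_differentiable o_def)
qed

lemma partial_eqI:
  "((\<lambda>t. f (x + t *\<^sub>R axis i 1)) has_real_derivative D) (at 0) \<Longrightarrow> partial i f x = D"
  unfolding partial_def by (rule DERIV_imp_deriv)

lemma Ck_on_Suc_0_differentiable:
  assumes "Ck_on (Suc 0) U f" "open U" "x \<in> U"
  shows "f differentiable (at x)"
proof -
  have "f differentiable (at x within U)"
    using assms(1,3) by (simp add: differentiable_on_def)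
  then show ?thesis unfolding at_within_open[OF assms(3,2)] .
qed

definition partial_mat :: "(real^'n::finite \<Rightarrow> real^'n^'n) \<Rightarrow> real^'n \<Rightarrow> 'n \<Rightarrow> real^'n^'n" where
  "partial_mat m x j = (\<chi> k l. partial j (\<lambda>z. m z $ k $ l) x)"

text \<open>The Christoffel symbols of the first kind of \<open>m\<close>, contracted twice with \<open>y\<close>.\<close>

definition geo_covector :: "(real^'n::finite \<Rightarrow> real^'n^'n) \<Rightarrow> real^'n \<Rightarrow> real^'n \<Rightarrow> real^'n" where
  "geo_covector m x y = (\<chi> n. (\<Sum>j\<in>UNIV. y $ j * (partial_mat m x j *v y) $ n)
      - y \<bullet> (partial_mat m x n *v y) / 2)"

text \<open>Exchanging the summation indices merges the first two terms of the symbol. The matrix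
  field is arbitrary, so the result covers both \<open>a\<close> and the Finslerian tensor at fixed
  \<open>y\<close>.\<close>

lemma christoffel_contract:
  "(\<Sum>i\<in>UNIV. \<Sum>j\<in>UNIV. christoffel m x k i j * y $ i * y $ j)
    = (matrix_inv (m x) *v geo_covector m x y) $ k"
proof -
  let ?d = "\<lambda>j n i. partial j (\<lambda>z. m z $ n $ i) x"
  let ?A = "\<lambda>n. \<Sum>i\<in>UNIV. \<Sum>j\<in>UNIV. ?d j n i * y $ i * y $ j"
  let ?C = "\<lambda>n. \<Sum>i\<in>UNIV. \<Sum>j\<in>UNIV. ?d n j i * y $ i * y $ j"
  have sw: "(\<Sum>i\<in>UNIV. \<Sum>j\<in>UNIV. ?d i n j * y $ i * y $ j) = ?A n" for n
    by (subst sum.swap) (simp add: mult_ac)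
  have "(\<Sum>i\<in>UNIV. \<Sum>j\<in>UNIV. christoffel m x k i j * y $ i * y $ j)
    = (\<Sum>i\<in>UNIV. \<Sum>j\<in>UNIV. \<Sum>n\<in>UNIV. matrix_inv (m x) $ k $ n *
        (1 / 2 * (?d j n i * y $ i * y $ j + ?d i n j * y $ i * y $ j - ?d n j i * y $ i * y $ j)))"
    unfolding christoffel_def sum_distrib_left sum_distrib_right
    by (intro sum.cong refl) (simp add: algebra_simps)
  also have "\<dots> = (\<Sum>n\<in>UNIV. \<Sum>i\<in>UNIV. \<Sum>j\<in>UNIV. matrix_inv (m x) $ k $ n *
        (1 / 2 * (?d j n i * y $ i * y $ j + ?d i n j * y $ i * y $ j - ?d n j i * y $ i * y $ j)))"
    by (rule trans[OF sum.cong[OF refl sum.swap] sum.swap])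
  also have "\<dots> = (\<Sum>n\<in>UNIV. matrix_inv (m x) $ k $ n * (1 / 2 * (?A n + ?A n - ?C n)))"
    unfolding sum_distrib_left[symmetric] sum.distrib sum_subtractf sw ..
  also have "\<dots> = (matrix_inv (m x) *v geo_covector m x y) $ k"
    unfolding matrix_vector_mult_def vec_lambda_beta
  proof (intro sum.cong refl arg_cong2[where f = "(*)"])
    fix n
    have "?A n = (\<Sum>j\<in>UNIV. y $ j * (partial_mat m x j *v y) $ n)"
      by (subst sum.swap) (simp add: partial_mat_def matrix_vector_mult_def sum_distrib_left mult_ac)
    moreover have "?C n = y \<bullet> (partial_mat m x n *v y)"
      by (subst sum.swap) (simp add: partial_mat_def matrix_vector_mult_def inner_vec_def sum_distrib_left mult_ac)
    ultimately show "1 / 2 * (?A n + ?A n - ?C n) = geo_covector m x y $ n"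
      by (simp add: geo_covector_def)
  qed
  finally show ?thesis .
qed

text \<open>After a third contraction the subtracted term is half of the first. This expresses the
  derivative of \<open>q\<close> in direction \<open>y\<close> through the covector.\<close>

lemma geo_covector_inner:
  "y \<bullet> geo_covector m x y = (\<Sum>j\<in>UNIV. y $ j * (y \<bullet> (partial_mat m x j *v y))) / 2"
proof -
  have "(\<Sum>n\<in>UNIV. y $ n * (\<Sum>j\<in>UNIV. y $ j * (partial_mat m x j *v y) $ n))
      = (\<Sum>j\<in>UNIV. y $ j * (y \<bullet> (partial_mat m x j *v y)))"
    unfolding inner_vec_def sum_distrib_left
    by (subst sum.swap) (simp add: mult_ac)
  then show ?thesis
    by (simp add: geo_covector_def inner_vec_def[of y "vec_lambda _"] right_diff_distrib sum_subtractf
        sum_divide_distrib[symmetric])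
qed

section \<open>Linear algebra of the metric tensor at a fixed point and vector\<close>

lemma matrix_inv_invertible:
  fixes A :: "'a::semiring_1^'n^'m"
  assumes "invertible A"
  shows "A ** matrix_inv A = mat 1" "matrix_inv A ** A = mat 1"
  using someI_ex[OF assms[unfolded invertible_def]] by (simp_all add: matrix_inv_def)

text \<open>With \<open>A = a(x)\<close>, \<open>fs_W * fs_v\<close> is the covector \<open>y\<^sub>n\<close>, half the fibre gradient of \<open>K\<^sup>2\<close>, and
  \<open>fs_Q\<close> is the fibre gradient of \<open>q\<close>.\<close>

definition fs_v :: "real^'n::finite^'n \<Rightarrow> real^'n \<Rightarrow> real \<Rightarrow> real \<Rightarrow> real^'n \<Rightarrow> real^'n" where
  "fs_v A b g q y = A *v y + (g * q) *\<^sub>R b"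

definition fs_Q :: "real^'n::finite^'n \<Rightarrow> real^'n \<Rightarrow> real \<Rightarrow> real^'n \<Rightarrow> real^'n" where
  "fs_Q A b q y = (1 / q) *\<^sub>R (A *v y - (b \<bullet> y) *\<^sub>R b)"

text \<open>Position and direction are frozen, and \<open>q\<close> is a number tied to them by its
  square. All that follows in the locale is identities between scalars and vectors, free of
  derivatives.\<close>

locale finsleroid_point =
  fixes A :: "real^'n::finite^'n" and b y :: "real^'n" and g q :: real
  assumes sym: "\<And>i j. A $ i $ j = A $ j $ i"
    and inv: "invertible A"
    and q_pos: "q > 0"
    and q_sq: "q\<^sup>2 = y \<bullet> (A *v y) - (b \<bullet> y)\<^sup>2"
    and g_bound: "-2 < g" "g < 2"
begin

abbreviation "\<beta> \<equiv> b \<bullet> y"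
abbreviation "bup \<equiv> matrix_inv A *v b"
abbreviation "B \<equiv> fs_B g \<beta> q"

abbreviation "v \<equiv> fs_v A b g q y"
abbreviation "Q \<equiv> fs_Q A b q y"

text \<open>The Finslerian metric tensor divided by \<open>fs_W\<close>.\<close>

definition H :: "real^'n \<Rightarrow> real^'n" where
  "H w = (g / B * (v \<bullet> w)) *\<^sub>R (q *\<^sub>R b - \<beta> *\<^sub>R Q) + A *v w + (g * (b \<bullet> w)) *\<^sub>R Q"

lemma A_adj: "w \<bullet> (A *v z) = z \<bullet> (A *v w)"
proof -
  have "transpose A = A" using sym by (simp add: transpose_def vec_eq_iff)
  then show ?thesis
    using dot_lmul_matrix[of w A z] vector_transpose_matrix[of w A] by (simp add: inner_commute)
qed

lemma A_inv: "A *v (matrix_inv A *v w) = w" "matrix_inv A *v (A *v w) = w"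
  using inv by (simp_all add: matrix_vector_mul_assoc matrix_inv_invertible)

lemma inv_adj: "w \<bullet> (matrix_inv A *v z) = z \<bullet> (matrix_inv A *v w)"
  using A_adj[of "matrix_inv A *v w" "matrix_inv A *v z"] by (simp add: A_inv inner_commute)

lemma B_pos: "B > 0"
  using fs_B_pos g_bound q_pos .

lemma B_eq: "B = \<beta>\<^sup>2 + g * \<beta> * q + q\<^sup>2"
  by (simp add: fs_B_def)

lemma v_eq: "v = q *\<^sub>R Q + (\<beta> + g * q) *\<^sub>R b"
  using q_pos by (simp add: fs_v_def fs_Q_def algebra_simps)

lemma Q_y: "Q \<bullet> y = q"
proof -
  have "Q \<bullet> y = (y \<bullet> (A *v y) - \<beta> * \<beta>) / q"
    by (simp add: fs_Q_def inner_diff_left diff_divide_distrib inner_commute[of y "A *v y"])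
  also have "y \<bullet> (A *v y) - \<beta> * \<beta> = q * q" using q_sq by (simp add: power2_eq_square)
  finally show ?thesis using q_pos by simp
qed

lemma v_y: "v \<bullet> y = B"
  by (simp add: v_eq inner_left_distrib Q_y B_eq power2_eq_square algebra_simps)

lemma v_w: "v \<bullet> w = q * (Q \<bullet> w) + (\<beta> + g * q) * (b \<bullet> w)"
  by (simp add: v_eq inner_left_distrib)

lemma Q_inv: "Q \<bullet> (matrix_inv A *v w) = (y \<bullet> w - \<beta> * (b \<bullet> (matrix_inv A *v w))) / q"
proof -
  have "(A *v y) \<bullet> (matrix_inv A *v w) = y \<bullet> w"
    using A_adj[of "matrix_inv A *v w" y] by (simp add: A_inv inner_commute)
  then show ?thesis by (simp add: fs_Q_def inner_diff_left)
qed

lemma H_y: "H y = v"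
  using q_pos B_pos unfolding H_def v_y by (simp add: fs_v_def algebra_simps)

text \<open>\<open>H\<close> is symmetric, and this is its transposed form. It puts the output on
  \<open>v\<close>, A w and \<open>b\<close>, which suits the comparison with the lowered
  spray.\<close>

lemma H_eq: "H w = (g / B * (q * (b \<bullet> w) - \<beta> * (Q \<bullet> w))) *\<^sub>R v + A *v w + (g * (Q \<bullet> w)) *\<^sub>R b"
proof -
  let ?s = "b \<bullet> w" and ?t = "Q \<bullet> w"
  \<comment> \<open>The variables \<xi> and \<eta> stand for components of \<open>b\<close> and
    \<open>Q\<close>; clearing the denominator \<open>B\<close> leaves a polynomial
    identity.\<close>
  have "(g / B * (q * ?t + (\<beta> + g * q) * ?s)) * (q * \<xi> - \<beta> * \<eta>) + g * ?s * \<eta>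
     = (g / B * (q * ?s - \<beta> * ?t)) * (q * \<eta> + (\<beta> + g * q) * \<xi>) + g * ?t * \<xi>" (is "?l = ?r") for \<xi> \<eta> :: real
  proof -
    have "B * ?l = g * ((q * ?t + (\<beta> + g * q) * ?s) * (q * \<xi> - \<beta> * \<eta>) + B * ?s * \<eta>)"
      using B_pos by (simp add: field_simps)
    also have "\<dots> = g * ((q * ?s - \<beta> * ?t) * (q * \<eta> + (\<beta> + g * q) * \<xi>) + B * ?t * \<xi>)"
      by (simp add: B_eq algebra_simps power2_eq_square)
    also have "\<dots> = B * ?r"
      using B_pos by (simp add: field_simps)
    finally show ?thesis using B_pos by simp
  qed
  then show ?thesis
    by (simp add: vec_eq_iff H_def v_w) (simp add: v_eq)
qed

text \<open>Pairing with \<open>y\<close> gives v . w = 0, which fixes Q . w in terms of b . w.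
  Pairing with \<open>bup\<close> then forces b . w = 0, so that A w = 0 remains.\<close>

lemma H_inj:
  assumes unit: "b \<bullet> bup = 1" and "H w = 0"
  shows "w = 0"
proof -
  let ?s = "b \<bullet> w" and ?t = "Q \<bullet> w"
  have Aw: "(A *v y) \<bullet> w = q * ?t + \<beta> * ?s"
    using v_w[of w] by (simp add: fs_v_def inner_left_distrib algebra_simps)
  have "0 = y \<bullet> H w" using assms by simp
  also have "\<dots> = g / B * (q * ?s - \<beta> * ?t) * (v \<bullet> y) + (A *v y) \<bullet> w + g * ?t * \<beta>"
    by (simp add: H_eq inner_right_distrib A_adj[of y w] inner_commute)
  also have "\<dots> = q * ?t + (\<beta> + g * q) * ?s"
    using B_pos by (simp add: v_y Aw algebra_simps)
  finally have 1: "?t = - (\<beta> + g * q) * ?s / q" using q_pos by (simp add: field_simps)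
  have vb: "bup \<bullet> v = \<beta> + g * q"
    using v_w[of bup] Q_inv[of b] unit by (simp add: inner_commute)
  have bA: "bup \<bullet> (A *v w) = b \<bullet> w"
    by (simp add: A_adj[of bup w] A_inv inner_commute[of w])
  have bb: "bup \<bullet> b = 1" using unit by (simp add: inner_commute)
  have "0 = bup \<bullet> H w" using assms by simp
  also have "\<dots> = g / B * (q * ?s - \<beta> * ?t) * (\<beta> + g * q) + ?s + g * ?t"
    by (simp add: H_eq inner_right_distrib bA bb vb)
  also have "\<dots> = ?s"
  proof -
    \<comment> \<open>The relation \<open>1\<close> makes \<open>B\<close> appear as a factor; the
      first term then cancels against g (Q . w).\<close>
    have "q * ?s - \<beta> * ?t = B * ?s / q"
      using q_pos by (simp add: 1 B_eq field_simps power2_eq_square)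
    then have "g / B * (q * ?s - \<beta> * ?t) = g * ?s / q" using B_pos by simp
    then have e: "g / B * (q * ?s - \<beta> * ?t) = g * ?s / q" .
    show ?thesis unfolding e unfolding 1 using q_pos by (simp add: field_simps)
  qed
  finally have s: "?s = 0" by simp
  then have "A *v w = 0" using assms 1 by (simp add: H_eq)
  then show ?thesis using A_inv(2)[of w] by simp
qed

text \<open>The heart of the verification: the claimed spray without E^k is lowered by
  \<open>H\<close>. Later \<open>c\<close> is the contracted curl of \<open>b\<close>, \<Gamma> the
  Riemannian geodesic covector, and \<open>b'\<close>, \<open>q'\<close> are the derivatives of b
  and q in direction \<open>y\<close>.\<close>

lemma H_spray_vector:
  fixes c \<Gamma> :: "real^'n" and b' q' ys :: real
  defines "\<gamma> \<equiv> matrix_inv A *v \<Gamma>"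
  assumes unit: "b \<bullet> bup = 1"
    and c: "y \<bullet> c = 0"
    and ys: "ys = b' - b \<bullet> \<gamma>"
    and q': "q' = (y \<bullet> \<Gamma> - \<beta> * b') / q"
  shows "H ((g * q) *\<^sub>R (matrix_inv A *v c + (g * \<beta> / q * (bup \<bullet> c)) *\<^sub>R bup - (g / q * (bup \<bullet> c)) *\<^sub>R y)
        + (g / q * ys) *\<^sub>R (y - \<beta> *\<^sub>R bup) + \<gamma>)
    = \<Gamma> + (g * q) *\<^sub>R c + (g * q') *\<^sub>R b + (g / B * (q * b' - \<beta> * q')) *\<^sub>R v"
    (is "H ?T = _")
proof -
  define \<sigma> where "\<sigma> = bup \<bullet> c"
  define s where "s = b \<bullet> \<gamma>"
  define t where "t = Q \<bullet> \<gamma>"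
  have b': "b' = ys + s" using ys by (simp add: s_def)
  have t: "t = (y \<bullet> \<Gamma> - \<beta> * s) / q" unfolding t_def s_def \<gamma>_def by (rule Q_inv)
  have q'_eq: "q' = t - \<beta> * ys / q" using q_pos by (simp add: q' t b' field_simps)
  have "b \<bullet> (matrix_inv A *v c) = \<sigma>" using inv_adj[of b c] by (simp add: \<sigma>_def inner_commute)
  moreover from this have "Q \<bullet> (matrix_inv A *v c) = - \<beta> * \<sigma> / q" using Q_inv[of c] c by simp
  moreover have "Q \<bullet> bup = 0" using Q_inv[of b] unit by (simp add: inner_commute)
  ultimately have bT: "b \<bullet> ?T = g * q * \<sigma> + s" and QT: "Q \<bullet> ?T = - g * \<beta> * \<sigma> - g\<^sup>2 * q * \<sigma> + g * ys + t"
    using unit q_pos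
    by (simp_all add: inner_right_distrib inner_diff_right Q_y \<sigma>_def[symmetric] s_def[symmetric] t_def[symmetric])
       (simp_all add: field_simps power2_eq_square)
  \<comment> \<open>Replacing A y by v - g q b leaves only \<open>v\<close>, \<open>b\<close>,
    \<open>c\<close> and \<Gamma> as vectors.\<close>
  have AT: "A *v ?T = (g * q) *\<^sub>R (c + (g * \<beta> / q * \<sigma>) *\<^sub>R b - (g / q * \<sigma>) *\<^sub>R (v - (g * q) *\<^sub>R b))
        + (g / q * ys) *\<^sub>R (v - (g * q) *\<^sub>R b - \<beta> *\<^sub>R b) + \<Gamma>"
    by (simp add: matrix_vector_right_distrib matrix_vector_mult_diff_distrib matrix_vector_mult_scaleR
        A_inv \<gamma>_def \<sigma>_def fs_v_def)
  \<comment> \<open>The surplus over the desired coefficient is exactly the negative of the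
    coefficient of \<open>v\<close> in \<open>AT\<close>.\<close>
  have coeff: "g / B * (q * (b \<bullet> ?T) - \<beta> * (Q \<bullet> ?T)) = g / B * (q * b' - \<beta> * q') + g\<^sup>2 * \<sigma> - g / q * ys"
  proof -
    have "q * (b \<bullet> ?T) - \<beta> * (Q \<bullet> ?T) = q * b' - \<beta> * q' + B * (g * \<sigma> - ys / q)"
      using q_pos unfolding bT QT b' q'_eq B_eq by (simp add: field_simps power2_eq_square)
    then have "g / B * (q * (b \<bullet> ?T) - \<beta> * (Q \<bullet> ?T))
        = g / B * (q * b' - \<beta> * q' + B * (g * \<sigma> - ys / q))" by (rule arg_cong)
    also have "\<dots> = g / B * (q * b' - \<beta> * q') + g\<^sup>2 * \<sigma> - g / q * ys"
      using B_pos q_pos by (simp add: field_simps power2_eq_square)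
    finally show ?thesis .
  qed
  have "H ?T = (g / B * (q * b' - \<beta> * q') + g\<^sup>2 * \<sigma> - g / q * ys) *\<^sub>R v + A *v ?T
      + (g * (- g * \<beta> * \<sigma> - g\<^sup>2 * q * \<sigma> + g * ys + t)) *\<^sub>R b"
    unfolding H_eq[of ?T] coeff unfolding QT ..
  also have "\<dots> = \<Gamma> + (g * q) *\<^sub>R c + (g * q') *\<^sub>R b + (g / B * (q * b' - \<beta> * q')) *\<^sub>R v"
  proof -
    define X where "X = g / B * (q * b' - \<beta> * (t - \<beta> * ys / q))"
    \<comment> \<open>\<open>algebra\<close> needs a polynomial problem: division by
      \<open>q\<close> becomes multiplication by \<open>e\<close> with q e = 1, while
      \<open>X\<close> hides the division by \<open>B\<close>. The Greek variables are components of
      \<open>v\<close>, \<open>b\<close>, \<open>c\<close> and \<Gamma>.\<close>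
    define e where "e = 1 / q"
    have e: "q * e = 1" "z / q = z * e" for z using q_pos by (simp_all add: e_def)
    have "(X + g\<^sup>2 * \<sigma> - g / q * ys) * \<xi> + (g * q * (\<zeta> + g * \<beta> / q * \<sigma> * \<eta> - g / q * \<sigma> * (\<xi> - g * q * \<eta>))
        + g / q * ys * (\<xi> - g * q * \<eta> - \<beta> * \<eta>) + \<kappa>)
        + g * (- g * \<beta> * \<sigma> - g\<^sup>2 * q * \<sigma> + g * ys + t) * \<eta>
      = \<kappa> + g * q * \<zeta> + g * (t - \<beta> * ys / q) * \<eta> + X * \<xi>" for \<xi> \<eta> \<zeta> \<kappa> :: real
      unfolding e(2) using e(1) by algebra
    then show ?thesis
      unfolding AT q'_eq X_def[symmetric]
      by (simp only: vec_eq_iff vector_add_component vector_minus_component vector_scaleR_component real_scaleR_def) blast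
  qed
  finally show ?thesis .
qed

end

section \<open>The Finslerian metric tensor and the spray in a chart\<close>

lemma form_val_eq_inner: "form_val b x y = b x \<bullet> y"
  by (simp add: form_val_def inner_vec_def)

lemma sum_eq_inner_mult: "(\<Sum>i\<in>UNIV. \<Sum>j\<in>UNIV. m $ i $ j * w $ i * w $ j) = w \<bullet> (m *v w)"
  for m :: "real^'n::finite^'n"
  by (simp add: inner_vec_def matrix_vector_mult_def sum_distrib_left mult_ac)

lemma inner_add_axis: "w \<bullet> (y + t *\<^sub>R axis i 1) = w \<bullet> y + t * w $ i" for w y :: "real^'n::finite"
  by (simp add: inner_right_distrib inner_axis)

text \<open>The spray involves only first derivatives in x, so smoothness of the data enters as
  differentiability.\<close>

locale finsleroid_chart =
  fixes U :: "(real^'n::finite) set" and a :: "real^'n \<Rightarrow> real^'n^'n"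
    and b :: "real^'n \<Rightarrow> real^'n" and g :: "real^'n \<Rightarrow> real"
  assumes open_U: "open U"
    and a_diff: "x \<in> U \<Longrightarrow> (\<lambda>z. a z $ i $ j) differentiable (at x)"
    and b_diff: "x \<in> U \<Longrightarrow> (\<lambda>z. b z $ i) differentiable (at x)"
    and g_diff: "x \<in> U \<Longrightarrow> g differentiable (at x)"
    and a_sym: "x \<in> U \<Longrightarrow> a x $ i $ j = a x $ j $ i"
    and a_pos: "x \<in> U \<Longrightarrow> w \<noteq> 0 \<Longrightarrow> w \<bullet> (a x *v w) > 0"
    and g_bound: "x \<in> U \<Longrightarrow> -2 < g x" "x \<in> U \<Longrightarrow> g x < 2"
begin

abbreviation "q \<equiv> fs_q a b"
abbreviation "\<beta> x y \<equiv> b x \<bullet> y"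
abbreviation "W x y \<equiv> fs_W (g x) (\<beta> x y) (q x y)"
abbreviation "B x y \<equiv> fs_B (g x) (\<beta> x y) (q x y)"
abbreviation "M x y \<equiv> fs_M (g x) (\<beta> x y) (q x y)"
abbreviation "K \<equiv> fs_K a b g"

abbreviation "v x y \<equiv> fs_v (a x) (b x) (g x) (q x y) y"
abbreviation "Q x y \<equiv> fs_Q (a x) (b x) (q x y) y"

abbreviation "db x j \<equiv> (\<chi> n. partial j (\<lambda>z. b z $ n) x)"

lemma a_invertible:
  assumes "x \<in> U"
  shows "invertible (a x)"
proof -
  have "w = 0" if "a x *v w = 0" for w
    using a_pos[OF assms, of w] that by fastforce
  then show ?thesis
    by (metis invertible_left_inverse matrix_left_invertible_ker)
qed

lemma q_eq: "x \<in> U \<Longrightarrow> q x y = sqrt (y \<bullet> (a x *v y) - (\<beta> x y)\<^sup>2)"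
proof -
  assume "x \<in> U"
  then have "y \<bullet> (a x *v y) \<ge> 0" using a_pos[of x y] by (cases "y = 0") auto
  then show ?thesis by (simp add: fs_q_def riem_norm_def sum_eq_inner_mult form_val_eq_inner)
qed

lemma q_sq: "x \<in> U \<Longrightarrow> q x y > 0 \<Longrightarrow> (q x y)\<^sup>2 = y \<bullet> (a x *v y) - (\<beta> x y)\<^sup>2"
  by (simp add: q_eq)

lemma point_locale:
  "x \<in> U \<Longrightarrow> q x y > 0 \<Longrightarrow> finsleroid_point (a x) (b x) y (g x) (q x y)"
  by unfold_locales (auto intro: a_sym a_invertible g_bound q_sq)

lemmas a_adj = finsleroid_point.A_adj[OF point_locale]
lemmas v_eq = finsleroid_point.v_eq[OF point_locale]
text \<open>Folds the combination (b + g q) b' + q q' of the scalar derivative rules back into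
  \<open>v\<close> when b' and q' are fibre derivatives.\<close>

lemma v_nth: "x \<in> U \<Longrightarrow> q x y > 0 \<Longrightarrow>
    v x y $ i = (\<beta> x y + g x * q x y) * b x $ i + q x y * Q x y $ i"
  by (simp add: v_eq)
lemmas B_pos = finsleroid_point.B_pos[OF point_locale]
lemmas H_def = finsleroid_point.H_def[OF point_locale]

abbreviation "H x y \<equiv> finsleroid_point.H (a x) (b x) y (g x) (q x y)"

lemma K_sq:
  assumes "x \<in> U" "q x y > 0"
  shows "(K x y)\<^sup>2 = B x y * W x y"
proof -
  have "B x y > 0" using assms g_bound by (intro fs_B_pos) auto
  then show ?thesis
    by (simp add: fs_K_def form_val_eq_inner power_mult_distrib fs_W_def exp_double[symmetric])
qed

lemma line_in_U:
  assumes "x \<in> U"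
  shows "eventually (\<lambda>t. x + t *\<^sub>R axis j 1 \<in> U) (nhds (0::real))"
proof -
  have "((\<lambda>t::real. x + t *\<^sub>R axis j 1) \<longlongrightarrow> x + 0 *\<^sub>R axis j 1) (nhds 0)"
    by (intro tendsto_intros filterlim_ident)
  then show ?thesis using assms open_U by (simp add: topological_tendstoD)
qed

section \<open>Fibre derivatives and the explicit metric tensor\<close>

lemma q_fibre_derivative:
  assumes "x \<in> U" "q x y > 0"
  shows "((\<lambda>t. q x (y + t *\<^sub>R axis i 1)) has_real_derivative Q x y $ i) (at 0)"
proof -
  have "(y + t *\<^sub>R axis i 1) \<bullet> (a x *v (y + t *\<^sub>R axis i 1))
     = y \<bullet> (a x *v y) + 2 * t * (a x *v y) $ i + t\<^sup>2 * (axis i 1 \<bullet> (a x *v axis i 1))" for t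
    using a_adj[OF assms, of y "axis i 1"]
    by (simp add: matrix_vector_right_distrib matrix_vector_mult_scaleR inner_left_distrib
        inner_right_distrib inner_axis' power2_eq_square algebra_simps)
  then have e: "q x (y + t *\<^sub>R axis i 1) = sqrt (y \<bullet> (a x *v y) + 2 * t * (a x *v y) $ i
       + t\<^sup>2 * (axis i 1 \<bullet> (a x *v axis i 1)) - (\<beta> x y + t * b x $ i)\<^sup>2)" for t
    using assms by (simp add: q_eq inner_add_axis)
  have "sqrt (y \<bullet> (a x *v y) - (\<beta> x y)\<^sup>2) > 0" using assms q_eq by simp
  then show ?thesis
    unfolding e using assms
    by (auto intro!: derivative_eq_intros simp: fs_Q_def q_eq field_simps)
qed

lemma \<beta>_fibre_derivative:
  "((\<lambda>t. \<beta> x (y + t *\<^sub>R axis i 1)) has_real_derivative b x $ i) (at 0)"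
  unfolding inner_add_axis by (auto intro!: derivative_eq_intros)

lemma fibre_q_pos:
  assumes "x \<in> U" "q x y > 0"
  shows "eventually (\<lambda>t. q x (y + t *\<^sub>R axis i 1) > 0) (nhds 0)"
  using order_tendstoD(1)[OF DERIV_imp_tendsto_nhds[OF q_fibre_derivative[OF assms, of i]]] assms by simp

lemma M_fibre_derivative:
  assumes "x \<in> U" "q x y > 0"
  shows "((\<lambda>t. M x (y + t *\<^sub>R axis i 1)) has_real_derivative
     2 * q x y / B x y * (b x $ i - \<beta> x y * v x y $ i / B x y)) (at 0)"
  using fs_M_has_derivative[OF g_bound[OF assms(1)] \<beta>_fibre_derivative[of x y i] q_fibre_derivative[OF assms, of i]] assms(2)
  by (simp add: v_nth assms)

lemma W_fibre_derivative:
  assumes "x \<in> U" "q x y > 0"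
  shows "((\<lambda>t. W x (y + t *\<^sub>R axis i 1)) has_real_derivative
     W x y * (g x * (q x y * b x $ i - \<beta> x y * Q x y $ i) / B x y)) (at 0)"
  using fs_W_has_derivative[OF DERIV_const[of "g x"] _ _ \<beta>_fibre_derivative[of x y i] q_fibre_derivative[OF assms, of i]]
    g_bound[OF assms(1)] assms(2) by simp

text \<open>K^2 = B W is available where q > 0, so the derivative is transferred from B W on a
  neighbourhood of t = 0.\<close>

lemma partial_K_sq:
  assumes "x \<in> U" "q x y > 0"
  shows "partial i (\<lambda>w. (K x w)\<^sup>2) y = 2 * (W x y * v x y $ i)"
proof (rule partial_eqI)
  have ev: "eventually (\<lambda>t. (K x (y + t *\<^sub>R axis i 1))\<^sup>2 =
      B x (y + t *\<^sub>R axis i 1) * W x (y + t *\<^sub>R axis i 1)) (nhds 0)"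
    using fibre_q_pos[OF assms, of i] by eventually_elim (simp add: K_sq assms)
  have "((\<lambda>t. B x (y + t *\<^sub>R axis i 1) * W x (y + t *\<^sub>R axis i 1)) has_real_derivative
      2 * (W x y * v x y $ i)) (at 0)"
    using fs_BW_has_derivative[OF DERIV_const[of "g x"] _ _ \<beta>_fibre_derivative[of x y i] q_fibre_derivative[OF assms, of i]]
      g_bound[OF assms(1)] assms(2) by (simp add: v_nth assms algebra_simps)
  then show "((\<lambda>t. (K x (y + t *\<^sub>R axis i 1))\<^sup>2) has_real_derivative 2 * (W x y * v x y $ i)) (at 0)"
    by (subst DERIV_cong_ev[OF refl ev refl])
qed

text \<open>Differentiates W v_j once more in direction i: the factor \<open>W\<close> yields the
  term with v_j, while A y and g q b yield the other two.\<close>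

lemma finsler_tensor_eq:
  assumes "x \<in> U" "q x y > 0"
  shows "finsler_tensor K x y $ i $ j = W x y *
    (g x * (q x y * b x $ i - \<beta> x y * Q x y $ i) / B x y * v x y $ j
      + a x $ i $ j + g x * b x $ j * Q x y $ i)"
proof -
  have ev: "eventually (\<lambda>t. partial j (\<lambda>w. (K x w)\<^sup>2) (y + t *\<^sub>R axis i 1) =
      2 * (W x (y + t *\<^sub>R axis i 1) * v x (y + t *\<^sub>R axis i 1) $ j)) (nhds 0)"
    using fibre_q_pos[OF assms, of i] by eventually_elim (simp add: partial_K_sq assms)
  have "(a x *v (y + t *\<^sub>R axis i 1)) $ j = (a x *v y) $ j + t * a x $ i $ j" for t
    using a_sym[OF assms(1), of j i]
    by (simp add: matrix_vector_right_distrib matrix_vector_mult_scaleR matrix_vector_mult_basis column_def)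
  note a_y = this
  have "((\<lambda>t. v x (y + t *\<^sub>R axis i 1) $ j) has_real_derivative
      a x $ i $ j + g x * b x $ j * Q x y $ i) (at 0)"
    unfolding fs_v_def vector_add_component a_y
    by (auto intro!: derivative_eq_intros q_fibre_derivative assms simp: algebra_simps)
  note DERIV_cmult[OF DERIV_mult[OF W_fibre_derivative[OF assms] this], of 2]
  then have "((\<lambda>t. partial j (\<lambda>w. (K x w)\<^sup>2) (y + t *\<^sub>R axis i 1)) has_real_derivative
      2 * (W x y * (g x * (q x y * b x $ i - \<beta> x y * Q x y $ i) / B x y * v x y $ j
      + a x $ i $ j + g x * b x $ j * Q x y $ i))) (at 0)"
    by (subst DERIV_cong_ev[OF refl ev refl]) (simp add: algebra_simps)
  from partial_eqI[OF this] show ?thesis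
    by (simp add: finsler_tensor_def)
qed

lemma finsler_tensor_mult:
  assumes "x \<in> U" "q x y > 0"
  shows "finsler_tensor K x y *v w = W x y *\<^sub>R H x y w"
proof (simp add: vec_eq_iff H_def assms, intro allI)
  fix i
  have "(finsler_tensor K x y *v w) $ i = (\<Sum>j\<in>UNIV. W x y *
    (g x * (q x y * b x $ i - \<beta> x y * Q x y $ i) / B x y * (v x y $ j * w $ j)
      + a x $ i $ j * w $ j + g x * Q x y $ i * (b x $ j * w $ j)))"
    unfolding matrix_vector_mult_def vec_lambda_beta finsler_tensor_eq[OF assms]
    by (intro sum.cong refl) (simp add: algebra_simps)
  also have "\<dots> = W x y * (g x * (q x y * b x $ i - \<beta> x y * Q x y $ i) / B x y * (v x y \<bullet> w)
      + (a x *v w) $ i + g x * Q x y $ i * \<beta> x w)"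
    by (simp only: sum.distrib sum_distrib_left[symmetric] inner_vec_def inner_real_def
        matrix_vector_mult_def vec_lambda_beta)
  also have "\<dots> = W x y * (g x * (v x y \<bullet> w) * (q x y * b x $ i - \<beta> x y * Q x y $ i) / B x y +
      (a x *v w) $ i + g x * \<beta> x w * Q x y $ i)"
    by (simp add: algebra_simps)
  finally show "(finsler_tensor K x y *v w) $ i = W x y * (g x * (v x y \<bullet> w) *
      (q x y * b x $ i - \<beta> x y * Q x y $ i) / B x y + (a x *v w) $ i + g x * \<beta> x w * Q x y $ i)" .
qed

lemma finsler_tensor_y:
  assumes "x \<in> U" "q x y > 0"
  shows "finsler_tensor K x y *v y = W x y *\<^sub>R v x y"
  using finsleroid_point.H_y[OF point_locale] assms by (simp add: finsler_tensor_mult)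

section \<open>Base derivatives with y held fixed\<close>

abbreviation "q' x y j \<equiv> (y \<bullet> (partial_mat a x j *v y) / 2 - \<beta> x y * (db x j \<bullet> y)) / q x y"

lemma a_base_derivative:
  "x \<in> U \<Longrightarrow> ((\<lambda>t. a (x + t *\<^sub>R axis j 1) $ m $ n) has_real_derivative partial_mat a x j $ m $ n) (at 0)"
  unfolding partial_mat_def vec_lambda_beta by (rule partial_has_derivative[OF a_diff])

lemma b_base_derivative:
  "x \<in> U \<Longrightarrow> ((\<lambda>t. b (x + t *\<^sub>R axis j 1) $ n) has_real_derivative db x j $ n) (at 0)"
  unfolding vec_lambda_beta by (rule partial_has_derivative[OF b_diff])

lemma g_base_derivative:
  "x \<in> U \<Longrightarrow> ((\<lambda>t. g (x + t *\<^sub>R axis j 1)) has_real_derivative partial j g x) (at 0)"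
  by (rule partial_has_derivative[OF g_diff])

lemma u_base_derivative:
  "x \<in> U \<Longrightarrow> ((\<lambda>t. (a (x + t *\<^sub>R axis j 1) *v y) $ n) has_real_derivative (partial_mat a x j *v y) $ n) (at 0)"
  unfolding matrix_vector_mult_def vec_lambda_beta
  by (auto intro!: DERIV_sum DERIV_cmult_right a_base_derivative)

lemma \<beta>_base_derivative:
  "x \<in> U \<Longrightarrow> ((\<lambda>t. \<beta> (x + t *\<^sub>R axis j 1) y) has_real_derivative db x j \<bullet> y) (at 0)"
  unfolding inner_vec_def inner_real_def
  by (intro DERIV_sum DERIV_cmult_right b_base_derivative)

lemma q_base_derivative:
  assumes "x \<in> U" "q x y > 0"
  shows "((\<lambda>t. q (x + t *\<^sub>R axis j 1) y) has_real_derivative q' x y j) (at 0)"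
proof -
  have ev: "eventually (\<lambda>t. q (x + t *\<^sub>R axis j 1) y =
      sqrt (y \<bullet> (a (x + t *\<^sub>R axis j 1) *v y) - (\<beta> (x + t *\<^sub>R axis j 1) y)\<^sup>2)) (nhds 0)"
    using line_in_U[OF assms(1), of j] by eventually_elim (rule q_eq)
  have "((\<lambda>t. y \<bullet> (a (x + t *\<^sub>R axis j 1) *v y)) has_real_derivative y \<bullet> (partial_mat a x j *v y)) (at 0)"
    unfolding inner_vec_def inner_real_def
    by (intro DERIV_sum DERIV_cmult u_base_derivative assms)
  moreover have "sqrt (y \<bullet> (a x *v y) - (\<beta> x y)\<^sup>2) > 0" using assms q_eq by simp
  ultimately show ?thesis
    using assms(1) by (subst DERIV_cong_ev[OF refl ev refl])
      (auto intro!: derivative_eq_intros \<beta>_base_derivative simp: q_eq field_simps)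
qed

lemma base_q_pos:
  assumes "x \<in> U" "q x y > 0"
  shows "eventually (\<lambda>t. q (x + t *\<^sub>R axis j 1) y > 0) (nhds 0)"
  using order_tendstoD(1)[OF DERIV_imp_tendsto_nhds[OF q_base_derivative[OF assms, of j]]] assms by simp

lemma W_base_derivative:
  assumes "x \<in> U" "q x y > 0"
  shows "((\<lambda>t. W (x + t *\<^sub>R axis j 1) y) has_real_derivative
     W x y * (g x * (q x y * (db x j \<bullet> y) - \<beta> x y * q' x y j) / B x y
       + (M x y - \<beta> x y * q x y / B x y) * partial j g x)) (at 0)"
  using fs_W_has_derivative[OF g_base_derivative[of x j] _ _ \<beta>_base_derivative[where x = x and y = y and j = j] q_base_derivative[OF assms, of j]]
    g_bound[OF assms(1)] assms by simp

lemma v_base_derivative: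
  assumes "x \<in> U" "q x y > 0"
  shows "((\<lambda>t. v (x + t *\<^sub>R axis j 1) y $ n) has_real_derivative
     (partial_mat a x j *v y) $ n + (partial j g x * q x y + g x * q' x y j) * b x $ n
       + g x * q x y * db x j $ n) (at 0)"
  unfolding fs_v_def vector_add_component vector_scaleR_component
  using DERIV_add[OF u_base_derivative DERIV_mult[OF DERIV_mult[OF g_base_derivative
      q_base_derivative[OF assms, of j]] b_base_derivative]] assms
  by (simp add: algebra_simps)

text \<open>Existence of the derivative is the point; its value is never expanded. Only contractions
  with \<open>y\<close> enter the spray, and these come from differentiating the short formulas F y
  = W v and y . F y = B W, where F is the metric tensor.\<close>

lemma finsler_tensor_base_derivative:
  assumes "x \<in> U" "q x y > 0"
  shows "((\<lambda>t. finsler_tensor K (x + t *\<^sub>R axis j 1) y $ m $ n) has_real_derivative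
     partial_mat (\<lambda>z. finsler_tensor K z y) x j $ m $ n) (at 0)"
proof -
  let ?x = "\<lambda>t. x + t *\<^sub>R axis j 1"
  have ev: "eventually (\<lambda>t. finsler_tensor K (?x t) y $ m $ n = W (?x t) y *
    (g (?x t) * (q (?x t) y * b (?x t) $ m - \<beta> (?x t) y *
        (1 / q (?x t) y * ((a (?x t) *v y) $ m - \<beta> (?x t) y * b (?x t) $ m))) / B (?x t) y * v (?x t) y $ n
      + a (?x t) $ m $ n + g (?x t) * b (?x t) $ n *
        (1 / q (?x t) y * ((a (?x t) *v y) $ m - \<beta> (?x t) y * b (?x t) $ m)))) (nhds 0)"
    using line_in_U[OF assms(1), of j] base_q_pos[OF assms, of j] by eventually_elim (simp add: finsler_tensor_eq fs_Q_def)
  note [derivative_intros] = W_base_derivative v_base_derivative q_base_derivative a_base_derivative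
    b_base_derivative \<beta>_base_derivative u_base_derivative g_base_derivative
  have "\<exists>D. ((\<lambda>t. finsler_tensor K (?x t) y $ m $ n) has_real_derivative D) (at 0)"
    unfolding DERIV_cong_ev[OF refl ev refl] fs_B_def
    apply (rule exI)
    apply (rule derivative_eq_intros refl assms | use assms B_pos[OF assms] in \<open>simp add: fs_B_def; fail\<close>)+
    done
  then show ?thesis
    by (auto simp: partial_mat_def partial_eqI)
qed

section \<open>Covariant derivatives of b contracted with y\<close>

lemma christoffel_sym:
  assumes "x \<in> U"
  shows "christoffel a x k i j = christoffel a x k j i"
proof -
  have "partial_mat a x n $ i $ j = partial_mat a x n $ j $ i" for n i j
  proof -
    have "eventually (\<lambda>t. a (x + t *\<^sub>R axis n 1) $ i $ j = a (x + t *\<^sub>R axis n 1) $ j $ i) (nhds 0)"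
      using line_in_U[OF assms, of n] by eventually_elim (rule a_sym)
    from DERIV_cong_ev[OF refl this refl] show ?thesis
      using a_base_derivative[OF assms] DERIV_unique by blast
  qed
  then have "partial n (\<lambda>z. a z $ i $ j) x = partial n (\<lambda>z. a z $ j $ i) x" for n i j
    by (simp add: partial_mat_def)
  then show ?thesis
    unfolding christoffel_def by (simp add: add.commute)
qed

text \<open>The exterior derivative of the 1-form, contracted with \<open>y\<close>.\<close>

definition curl :: "real^'n \<Rightarrow> real^'n \<Rightarrow> real^'n" where
  "curl x y = (\<chi> n. (\<Sum>j\<in>UNIV. y $ j * db x j $ n) - db x n \<bullet> y)"

text \<open>The connection terms cancel in the antisymmetrised covariant derivative because the
  Christoffel symbols are symmetric.\<close>

lemma curl_cov_deriv:
  assumes "x \<in> U"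
  shows "(\<Sum>h\<in>UNIV. y $ h * (cov_deriv a b x h j - cov_deriv a b x j h)) = curl x y $ j"
  unfolding cov_deriv_def curl_def christoffel_sym[OF assms, of _ j]
  by (simp add: inner_vec_def right_diff_distrib sum_subtractf mult.commute)

text \<open>Antisymmetry; it discharges the orthogonality premise of
  \<open>H_spray_vector\<close>.\<close>

lemma curl_y: "y \<bullet> curl x y = 0"
proof -
  have "(\<Sum>n\<in>UNIV. y $ n * (\<Sum>j\<in>UNIV. y $ j * db x j $ n)) = (\<Sum>n\<in>UNIV. y $ n * (db x n \<bullet> y))"
    unfolding sum_distrib_left inner_vec_def inner_real_def by (subst sum.swap) (simp add: mult_ac)
  then show ?thesis
    by (simp add: curl_def inner_vec_def[of y "vec_lambda _"] right_diff_distrib sum_subtractf)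
qed

abbreviation "\<beta>' x y \<equiv> \<Sum>j\<in>UNIV. y $ j * (db x j \<bullet> y)"

text \<open>Brings (ys) into the shape required by \<open>H_spray_vector\<close>: the derivative of
  b in direction \<open>y\<close> minus its connection part.\<close>

lemma cov_deriv_yy:
  "(\<Sum>h\<in>UNIV. y $ h * (\<Sum>m\<in>UNIV. y $ m * cov_deriv a b x h m))
    = \<beta>' x y - b x \<bullet> (matrix_inv (a x) *v geo_covector a x y)"
proof -
  have "(\<Sum>h\<in>UNIV. \<Sum>m\<in>UNIV. \<Sum>k\<in>UNIV. b x $ k * (christoffel a x k h m * y $ h * y $ m))
      = (\<Sum>k\<in>UNIV. \<Sum>h\<in>UNIV. \<Sum>m\<in>UNIV. b x $ k * (christoffel a x k h m * y $ h * y $ m))"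
    by (rule trans[OF sum.cong[OF refl sum.swap] sum.swap])
  also have "\<dots> = b x \<bullet> (matrix_inv (a x) *v geo_covector a x y)"
    by (simp only: sum_distrib_left[symmetric] christoffel_contract inner_vec_def inner_real_def)
  finally have "b x \<bullet> (matrix_inv (a x) *v geo_covector a x y) =
     (\<Sum>h\<in>UNIV. y $ h * (\<Sum>m\<in>UNIV. y $ m * (\<Sum>k\<in>UNIV. b x $ k * christoffel a x k h m)))"
    by (simp add: sum_distrib_left mult_ac)
  then show ?thesis
    by (simp add: cov_deriv_def inner_vec_def[of "vec_lambda _"] right_diff_distrib sum_subtractf mult.commute)
qed

lemma q'_contract:
  "(\<Sum>j\<in>UNIV. y $ j * q' x y j) = (y \<bullet> geo_covector a x y - \<beta> x y * \<beta>' x y) / q x y"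
proof -
  have "(\<Sum>j\<in>UNIV. y $ j * q' x y j)
     = (\<Sum>j\<in>UNIV. (y $ j * (y \<bullet> (partial_mat a x j *v y)) / 2 - \<beta> x y * (y $ j * (db x j \<bullet> y))) / q x y)"
    by (intro sum.cong refl) (simp add: algebra_simps)
  then show ?thesis
    by (simp only: sum_divide_distrib[symmetric] sum_subtractf sum_distrib_left[symmetric] geo_covector_inner)
qed

section \<open>The lowered spray and its solution\<close>

lemma partial_tensor_y:
  assumes "x \<in> U" "q x y > 0"
  shows "(partial_mat (\<lambda>z. finsler_tensor K z y) x j *v y) $ n =
    W x y * (g x * (q x y * (db x j \<bullet> y) - \<beta> x y * q' x y j) / B x y
       + (M x y - \<beta> x y * q x y / B x y) * partial j g x) * v x y $ n
    + W x y * ((partial_mat a x j *v y) $ n + (partial j g x * q x y + g x * q' x y j) * b x $ n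
       + g x * q x y * db x j $ n)" (is "_ = ?D")
proof (rule DERIV_unique)
  have ev: "eventually (\<lambda>t. (finsler_tensor K (x + t *\<^sub>R axis j 1) y *v y) $ n =
      W (x + t *\<^sub>R axis j 1) y * v (x + t *\<^sub>R axis j 1) y $ n) (nhds 0)"
    using line_in_U[OF assms(1), of j] base_q_pos[OF assms, of j]
    by eventually_elim (simp add: finsler_tensor_y)
  show "((\<lambda>t. (finsler_tensor K (x + t *\<^sub>R axis j 1) y *v y) $ n) has_real_derivative ?D) (at 0)"
    unfolding DERIV_cong_ev[OF refl ev refl]
    using DERIV_mult[OF W_base_derivative[OF assms] v_base_derivative[OF assms], of j j n]
    by (simp only: add.commute mult.commute scaleR_zero_left add_0_left add_0_right)
  show "((\<lambda>t. (finsler_tensor K (x + t *\<^sub>R axis j 1) y *v y) $ n) has_real_derivative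
      (partial_mat (\<lambda>z. finsler_tensor K z y) x j *v y) $ n) (at 0)"
    unfolding matrix_vector_mult_def vec_lambda_beta
    by (intro DERIV_sum DERIV_cmult_right finsler_tensor_base_derivative[OF assms])
qed

text \<open>The left side is the derivative of y . F y = K^2 at fixed \<open>y\<close>, so
  \<open>fs_BW_has_derivative\<close> applies without expanding the tensor; its g-term is the source
  of M K^2 g_h in E^k.\<close>

lemma partial_tensor_yy:
  assumes "x \<in> U" "q x y > 0"
  shows "y \<bullet> (partial_mat (\<lambda>z. finsler_tensor K z y) x j *v y) =
    2 * W x y * ((\<beta> x y + g x * q x y) * (db x j \<bullet> y) + q x y * q' x y j)
    + M x y * (B x y * W x y) * partial j g x" (is "_ = ?D")
proof (rule DERIV_unique)
  have ev: "eventually (\<lambda>t. y \<bullet> (finsler_tensor K (x + t *\<^sub>R axis j 1) y *v y) =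
      B (x + t *\<^sub>R axis j 1) y * W (x + t *\<^sub>R axis j 1) y) (nhds 0)"
    using line_in_U[OF assms(1), of j] base_q_pos[OF assms, of j]
    by eventually_elim (simp add: finsler_tensor_y inner_commute[of y] finsleroid_point.v_y[OF point_locale])
  show "((\<lambda>t. y \<bullet> (finsler_tensor K (x + t *\<^sub>R axis j 1) y *v y)) has_real_derivative ?D) (at 0)"
    unfolding DERIV_cong_ev[OF refl ev refl]
    using fs_BW_has_derivative[OF g_base_derivative[of x j] _ _ \<beta>_base_derivative[where x = x and y = y and j = j]
        q_base_derivative[OF assms, of j]] g_bound[OF assms(1)] assms
    by simp
  show "((\<lambda>t. y \<bullet> (finsler_tensor K (x + t *\<^sub>R axis j 1) y *v y)) has_real_derivative
      y \<bullet> (partial_mat (\<lambda>z. finsler_tensor K z y) x j *v y)) (at 0)"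
    unfolding matrix_vector_mult_def inner_vec_def inner_real_def vec_lambda_beta
    by (intro DERIV_sum DERIV_cmult DERIV_cmult_right finsler_tensor_base_derivative[OF assms])
qed

abbreviation "dg x \<equiv> (\<chi> n. partial n g x)"
abbreviation "dM x y \<equiv> (\<chi> n. partial n (\<lambda>w. M x w) y)"

lemma dM_eq:
  assumes "x \<in> U" "q x y > 0"
  shows "dM x y = (2 * q x y / B x y) *\<^sub>R (b x - (\<beta> x y / B x y) *\<^sub>R v x y)"
  by (simp add: vec_eq_iff partial_eqI[OF M_fibre_derivative[OF assms]] algebra_simps)

text \<open>The lowered spray sorted by origin: the terms free of \<open>dg\<close> form
  \<open>W\<close> times the right-hand side of \<open>H_spray_vector\<close>, and those with
  \<open>dg\<close> form the lowered E^k.\<close>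

lemma geo_covector_tensor:
  fixes x y :: "real^'n"
  defines "bd \<equiv> \<beta>' x y" and "qd \<equiv> (y \<bullet> geo_covector a x y - \<beta> x y * \<beta>' x y) / q x y"
    and "yg \<equiv> y \<bullet> dg x"
  assumes "x \<in> U" "q x y > 0"
  shows "geo_covector (\<lambda>z. finsler_tensor K z y) x y =
    W x y *\<^sub>R (geo_covector a x y + (g x * q x y) *\<^sub>R curl x y + (g x * qd) *\<^sub>R b x
       + (g x / B x y * (q x y * bd - \<beta> x y * qd)) *\<^sub>R v x y)
    + (M x y * yg) *\<^sub>R (W x y *\<^sub>R v x y) + (1 / 2 * (B x y * W x y) * yg) *\<^sub>R dM x y
    - (1 / 2 * M x y * (B x y * W x y)) *\<^sub>R dg x"
proof -
  let ?F = "partial_mat (\<lambda>z. finsler_tensor K z y) x"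
  have yg: "yg = (\<Sum>j\<in>UNIV. y $ j * partial j g x)"
    by (simp add: yg_def inner_vec_def)
  have qd: "qd = (\<Sum>j\<in>UNIV. y $ j * q' x y j)"
    by (simp only: q'_contract qd_def)
  have "geo_covector (\<lambda>z. finsler_tensor K z y) x y $ n =
     W x y * (geo_covector a x y $ n + g x * q x y * curl x y $ n + g x * qd * b x $ n
       + g x / B x y * (q x y * bd - \<beta> x y * qd) * v x y $ n)
    + W x y * (M x y - \<beta> x y * q x y / B x y) * yg * v x y $ n + W x y * q x y * yg * b x $ n
    - 1 / 2 * M x y * (B x y * W x y) * partial n g x" for n
  proof -
    have "y $ j * (?F j *v y) $ n =
       W x y * (g x / B x y) * v x y $ n * q x y * (y $ j * (db x j \<bullet> y))
       + W x y * (g x * b x $ n - g x / B x y * v x y $ n * \<beta> x y) * (y $ j * q' x y j)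
       + W x y * ((M x y - \<beta> x y * q x y / B x y) * v x y $ n + q x y * b x $ n) * (y $ j * partial j g x)
       + W x y * (y $ j * (partial_mat a x j *v y) $ n)
       + W x y * g x * q x y * (y $ j * db x j $ n)" for j
    proof -
      have gen: "Y * (w * (G * (\<kappa> * d - be * Q1) / B1 + m * p) * V + w * (u + (p * \<kappa> + G * Q1) * b1 + G * \<kappa> * e)) =
         w * (G / B1) * V * \<kappa> * (Y * d) + w * (G * b1 - G / B1 * V * be) * (Y * Q1)
         + w * (m * V + \<kappa> * b1) * (Y * p) + w * (Y * u) + w * G * \<kappa> * (Y * e)"
        for Y w G \<kappa> d be Q1 B1 m p V u b1 e :: real
        by (simp add: diff_divide_distrib algebra_simps)
      show ?thesis unfolding partial_tensor_y[OF assms(4,5)] by (rule gen)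
    qed
    then have "(\<Sum>j\<in>UNIV. y $ j * (?F j *v y) $ n) =
       W x y * (g x / B x y) * v x y $ n * q x y * bd
       + W x y * (g x * b x $ n - g x / B x y * v x y $ n * \<beta> x y) * qd
       + W x y * ((M x y - \<beta> x y * q x y / B x y) * v x y $ n + q x y * b x $ n) * yg
       + W x y * (\<Sum>j\<in>UNIV. y $ j * (partial_mat a x j *v y) $ n)
       + W x y * g x * q x y * (\<Sum>j\<in>UNIV. y $ j * db x j $ n)"
      unfolding yg qd bd_def by (simp only: sum.distrib sum_distrib_left)
    \<comment> \<open>Multiplying by \<open>q\<close> removes the denominator of \<open>q'\<close>;
      its term with the derivative of b then cancels the matching part of (b + g q).\<close>
    moreover have "q x y * q' x y n = y \<bullet> (partial_mat a x n *v y) / 2 - \<beta> x y * (db x n \<bullet> y)"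
      using assms(5) by simp
    then have "y \<bullet> (?F n *v y) / 2 =
        W x y * (y \<bullet> (partial_mat a x n *v y) / 2 + g x * q x y * (db x n \<bullet> y))
        + 1 / 2 * M x y * (B x y * W x y) * partial n g x"
      by (simp only: partial_tensor_yy[OF assms(4,5)]) (simp add: algebra_simps)
    moreover have gen: "(w * (G / B1) * V * \<kappa> * bd + w * (G * b1 - G / B1 * V * be) * qd
         + w * (m * V + \<kappa> * b1) * yg + w * X + w * G * \<kappa> * Z) - (w * (X' + G * \<kappa> * Z') + R)
       = w * ((X - X') + G * \<kappa> * (Z - Z') + G * qd * b1 + G / B1 * (\<kappa> * bd - be * qd) * V)
         + w * m * yg * V + w * \<kappa> * yg * b1 - R" for w G B1 V \<kappa> b1 be m X Z X' Z' R :: real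
      by (simp add: algebra_simps)
    ultimately show ?thesis
      by (simp only: geo_covector_def curl_def vec_lambda_beta gen)
  qed
  \<comment> \<open>The leftover terms, from b q/B in the derivative of \<open>W\<close> and from
    varying \<open>g\<close> in g q b, are precisely those of the fibre gradient of
    \<open>M\<close>.\<close>
  moreover have "1 / 2 * (B x y * W x y) * yg * dM x y $ n =
      W x y * q x y * yg * b x $ n - W x y * (\<beta> x y * q x y / B x y) * yg * v x y $ n" for n
    using B_pos[OF assms(4,5)] unfolding dM_eq[OF assms(4,5)] by (simp add: field_simps)
  ultimately show ?thesis
    unfolding vec_eq_iff vector_add_component vector_minus_component vector_scaleR_component real_scaleR_def
    by (simp only: vec_lambda_beta) (simp add: algebra_simps)
qed

lemma finsler_tensor_invertible:
  assumes "x \<in> U" "q x y > 0" "b x \<bullet> (matrix_inv (a x) *v b x) = 1"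
  shows "invertible (finsler_tensor K x y)"
proof -
  have "w = 0" if "finsler_tensor K x y *v w = 0" for w
    using that finsleroid_point.H_inj[OF point_locale[OF assms(1,2)] assms(3)] fs_W_pos
    by (simp add: finsler_tensor_mult assms(1,2) less_imp_neq[OF fs_W_pos, symmetric])
  then show ?thesis
    by (metis invertible_left_inverse matrix_left_invertible_ker)
qed

text \<open>Each term of the lowered spray is exhibited as F applied to a vector, except those in
  \<open>dM\<close> and \<open>dg\<close>, which keep the factor \<open>ginv\<close> just as E^k
  does. Applying \<open>ginv\<close> gives the spray.\<close>

lemma spray_eq:
  fixes x y :: "real^'n"
  defines "ainv \<equiv> matrix_inv (a x)" and "ginv \<equiv> matrix_inv (finsler_tensor K x y)"
  defines "bup \<equiv> ainv *v b x" and "\<gamma> \<equiv> ainv *v geo_covector a x y"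
    and "c \<equiv> curl x y" and "ys \<equiv> \<beta>' x y - b x \<bullet> (ainv *v geo_covector a x y)" and "yg \<equiv> y \<bullet> dg x"
  assumes xU: "x \<in> U" and q: "q x y > 0" and unit: "b x \<bullet> bup = 1"
  shows "spray K x y k =
    ((g x * q x y) *\<^sub>R (ainv *v c + (g x * \<beta> x y / q x y * (bup \<bullet> c)) *\<^sub>R bup - (g x / q x y * (bup \<bullet> c)) *\<^sub>R y)
       + (g x / q x y * ys) *\<^sub>R (y - \<beta> x y *\<^sub>R bup) + \<gamma>
       + ((M x y * yg) *\<^sub>R y + (1 / 2 * (K x y)\<^sup>2 * yg) *\<^sub>R (ginv *v dM x y)
          - (1 / 2 * M x y * (K x y)\<^sup>2) *\<^sub>R (ginv *v dg x))) $ k"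
proof -
  let ?F = "finsler_tensor K x y"
  define T where "T = (g x * q x y) *\<^sub>R (ainv *v c + (g x * \<beta> x y / q x y * (bup \<bullet> c)) *\<^sub>R bup - (g x / q x y * (bup \<bullet> c)) *\<^sub>R y)
       + (g x / q x y * ys) *\<^sub>R (y - \<beta> x y *\<^sub>R bup) + \<gamma>"
  have "geo_covector (\<lambda>z. finsler_tensor K z y) x y = ?F *v T + (M x y * yg) *\<^sub>R (?F *v y)
      + (1 / 2 * (K x y)\<^sup>2 * yg) *\<^sub>R dM x y - (1 / 2 * M x y * (K x y)\<^sup>2) *\<^sub>R dg x"
    unfolding finsler_tensor_y[OF xU q] K_sq[OF xU q]
    unfolding finsler_tensor_mult[OF xU q] T_def \<gamma>_def bup_def ainv_def
    by (subst finsleroid_point.H_spray_vector[OF point_locale[OF xU q] unit[unfolded bup_def ainv_def] _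
           ys_def[THEN meta_eq_to_obj_eq, unfolded ainv_def] refl])
       (simp_all only: c_def curl_y geo_covector_tensor[OF xU q] yg_def)
  then have "ginv *v geo_covector (\<lambda>z. finsler_tensor K z y) x y = T + (M x y * yg) *\<^sub>R y
      + (1 / 2 * (K x y)\<^sup>2 * yg) *\<^sub>R (ginv *v dM x y) - (1 / 2 * M x y * (K x y)\<^sup>2) *\<^sub>R (ginv *v dg x)"
    using matrix_inv_invertible(2)[OF finsler_tensor_invertible[OF xU q unit[unfolded bup_def ainv_def]]]
    by (simp add: matrix_vector_right_distrib matrix_vector_mult_diff_distrib matrix_vector_mult_scaleR
        matrix_vector_mul_assoc ginv_def)
  then show ?thesis
    unfolding spray_def christoffel_contract ginv_def[symmetric] T_def[symmetric] by simp
qed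

end

section \<open>From the data on the manifold to one chart\<close>

lemma finsleroid_chartI:
  assumes fd: "finsleroid_data X \<A> \<a> \<b> \<g>" and c: "c \<in> \<A>"
  shows "finsleroid_chart (chart_image c) (\<a> c) (\<b> c) (\<g> \<circ> chart_inv c)"
proof
  have c_op: "openin X (fst c)" and op: "open (chart_image c)"
    using fd c by (auto simp: finsleroid_data_def smooth_manifold_def)
  show "open (chart_image c)" by (rule op)
  fix x assume x: "x \<in> chart_image c"
  have smooth: "f differentiable (at x)" if "smooth_on (chart_image c) f" for f
    using that op x by (intro Ck_on_Suc_0_differentiable) (auto simp: smooth_on_def)
  show "(\<lambda>z. \<a> c z $ i $ j) differentiable (at x)" for i j
    using fd c by (intro smooth) (auto simp: finsleroid_data_def riemannian_metric_def)
  show "(\<lambda>z. \<b> c z $ i) differentiable (at x)" for i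
    using fd c by (intro smooth) (auto simp: finsleroid_data_def smooth_one_form_def)
  show "\<g> \<circ> chart_inv c differentiable (at x)"
    using fd c by (intro smooth) (auto simp: finsleroid_data_def smooth_scalar_def)
  show "\<a> c x $ i $ j = \<a> c x $ j $ i" for i j
    using fd c x by (auto simp: finsleroid_data_def riemannian_metric_def)
  show "w \<bullet> (\<a> c x *v w) > 0" if "w \<noteq> 0" for w
    using fd c x that by (simp add: finsleroid_data_def riemannian_metric_def flip: sum_eq_inner_mult)
  \<comment> \<open>On the chart image \<open>inv_into\<close> returns a genuine preimage, so the
    bounds on the charge apply to its value.\<close>
  have "chart_inv c x \<in> topspace X"
    using x openin_subset[OF c_op] inv_into_into[of x "snd c" "fst c"]
    by (auto simp: chart_inv_def chart_image_def)
  then show "- 2 < (\<g> \<circ> chart_inv c) x" "(\<g> \<circ> chart_inv c) x < 2"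
    using fd by (auto simp: finsleroid_data_def)
qed

theorem theoremB1:
  fixes X :: "'m topology"
    and \<A> :: "('m, 'n::finite) chart set"
    and \<a> :: "('m, 'n) chart \<Rightarrow> real^'n \<Rightarrow> real^'n^'n"
    and \<b> :: "('m, 'n) chart \<Rightarrow> real^'n \<Rightarrow> real^'n"
    and \<g> :: "'m \<Rightarrow> real"
    and c :: "('m, 'n) chart" and P :: 'm and y :: "real^'n" and k :: 'n
  assumes "finsleroid_data X \<A> \<a> \<b> \<g>"
    and "c \<in> \<A>" and "P \<in> fst c"
    and "fs_q (\<a> c) (\<b> c) (snd c P) y > 0"
  shows
    "let x = snd c P;
         a = \<a> c;
         bf = \<b> c;
         gf = \<g> \<circ> chart_inv c;
         K = fs_K a bf gf;
         g = gf x;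
         b = form_val bf x y;
         q = fs_q a bf x y;
         ainv = matrix_inv (a x);
         bup = (\<lambda>i. \<Sum>j\<in>UNIV. ainv $ i $ j * bf x $ j);
         nabla = cov_deriv a bf x;
         s = (\<lambda>i. \<Sum>m\<in>UNIV. y $ m * nabla i m);
         ys = (\<Sum>h\<in>UNIV. y $ h * s h);
         p = g * b / q;
         r = - (g / q);
         ginv = matrix_inv (finsler_tensor K x y);
         M = (\<lambda>v. fs_M g (form_val bf x v) (fs_q a bf x v));
         dM = (\<lambda>h. partial h M y);
         dg = (\<lambda>h. partial h gf x);
         yg = (\<Sum>i\<in>UNIV. y $ i * dg i);
         E = M y * yg * y $ k
             + 1 / 2 * (K x y)\<^sup>2 * yg * (\<Sum>h\<in>UNIV. dM h * ginv $ k $ h)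
             - 1 / 2 * M y * (K x y)\<^sup>2 * (\<Sum>h\<in>UNIV. dg h * ginv $ k $ h)
     in spray K x y k =
          g * q * (\<Sum>j\<in>UNIV. (ainv $ k $ j + (p * bup k + r * y $ k) * bup j)
                     * (\<Sum>h\<in>UNIV. y $ h * (nabla h j - nabla j h)))
          + g / q * (y $ k - b * bup k) * ys
          + (\<Sum>m\<in>UNIV. \<Sum>n\<in>UNIV. christoffel a x k m n * y $ m * y $ n)
          + E"
proof -
  interpret finsleroid_chart "chart_image c" "\<a> c" "\<b> c" "\<g> \<circ> chart_inv c"
    using assms(1,2) by (rule finsleroid_chartI)
  define x where "x = snd c P"
  have xU: "x \<in> chart_image c"
    using assms(3) by (auto simp: x_def chart_image_def)
  have q: "q x y > 0"
    using assms(4) by (simp add: x_def)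
  have unit: "\<b> c x \<bullet> (matrix_inv (\<a> c x) *v \<b> c x) = 1"
    using assms(1,2) xU by (simp add: finsleroid_data_def flip: sum_eq_inner_mult)
  define ainv where "ainv = matrix_inv (\<a> c x)"
  have up: "(\<Sum>j\<in>UNIV. ainv $ i $ j * \<b> c x $ j) = (ainv *v \<b> c x) $ i" for i
    by (simp add: matrix_vector_mult_def)
  have mv: "(\<Sum>h\<in>UNIV. w h * m $ k $ h) = (m *v (\<chi> h. w h)) $ k" for w and m :: "real^'n^'n"
    by (simp add: matrix_vector_mult_def mult.commute)
  have yg: "(\<Sum>i\<in>UNIV. y $ i * w i) = y \<bullet> (\<chi> i. w i)" for w
    by (simp add: inner_vec_def)
  \<comment> \<open>With \<open>s\<close> = p b^k + r y^k the bracket splits into the raised curl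
    and a multiple of its pairing with the raised \<open>b\<close>.\<close>
  have curl_part: "(\<Sum>j\<in>UNIV. (ainv $ k $ j + s * (ainv *v \<b> c x) $ j) * curl x y $ j)
      = (ainv *v curl x y) $ k + s * ((ainv *v \<b> c x) \<bullet> curl x y)" for s
    by (simp add: matrix_vector_mult_def[of ainv "curl x y"] inner_vec_def distrib_right sum.distrib sum_distrib_left mult.assoc)
  show ?thesis
    unfolding Let_def x_def[symmetric] ainv_def[symmetric] form_val_eq_inner up
      curl_cov_deriv[OF xU] cov_deriv_yy christoffel_contract curl_part mv
      yg[of "\<lambda>i. partial i (\<g> \<circ> chart_inv c) x"]
    unfolding spray_eq[OF xU q unit] ainv_def[symmetric]
    by (simp add: algebra_simps)
qed

end
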